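(* Let $n \in \mathbb{N}$ with $n \geqslant 2$, and let $U : T[\tfrac{1}{n},\mathcal{S}_1] \to T[\tfrac{1}{n},\mathcal{S}_1]$ be a bounded linear operator. Then $U \in \mathrm{Isom}(T[\tfrac{1}{n},\mathcal{S}_1])$ if and only if there are a permutation $\pi$ of $\{1,\dots,n\}$ and a sequence $(\varepsilon_i)_{i=1}^\infty \subset \{1,-1\}$ such that $Ue_i = \varepsilon_i e_{\pi(i)}$ for $1 \leqslant i \leqslant n$ and $Ue_i = \varepsilon_i e_i$ for all $i \geqslant n+1$.
   Context: All spaces are real and $\mathbb{N}=\{1,2,3,\dots\}$. For a real Banach space $X$, $\mathrm{Isom}(X)$ denotes the group of all surjective linear isometries $X \to X$. Let $c_{00}$ be the space of finitely supported real sequences indexed by $\mathbb{N}$, with standard unit vectors $(e_i)_{i=1}^\infty$. For $x \in c_{00}$ and $E \subset \mathbb{N}$, $Ex$ denotes the projection of $x$ onto the coordinates in $E$ (coordinates outside $E$ are replaced by $0$). For nonempty $E,F \subset \mathbb{N}$, write $E<F$ if $\max E < \min F$. The Schreier family is $\mathcal{S}_1 = \{F \subset \mathbb{N} : F \text{ finite and nonempty},\ |F| \leqslant \min F\} \cup \{\emptyset\}$. For $\theta \in (0,1)$, the Tsirelson-type space $T[\theta,\mathcal{S}_1]$ is defined as follows. Let $\|\cdot\|_0$ be the supremum norm on $c_{00}$ and, given $\|\cdot\|_k$, set $$\|x\|_{k+1} = \max\Big\{ \|x\|_k,\ \sup\Big\{ \theta \sum_{i=1}^d \|E_i x\|_k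 : d\in\mathbb{N},\ E_1 < \cdots < E_d \text{ nonempty subsets of } \mathbb{N},\ \{\min E_i : 1\leqslant i \leqslant d\} \in \mathcal{S}_1 \Big\}\Big\}.$$ Set $\|x\|_{\theta,\mathcal{S}_1} = \sup_{k} \|x\|_k$ for $x \in c_{00}$. Then $T[\theta,\mathcal{S}_1]$ is the completion of $c_{00}$ with respect to the norm $\|\cdot\|_{\theta,\mathcal{S}_1}$. Here $\theta = \tfrac1n$. *)

theory Defs
  imports "HOL-Analysis.Analysis" "HOL-Combinatorics.Permutations"
begin

text \<open>
  The index set of all sequences is \<open>{1, 2, 3, \<dots>}\<close>.  A sequence is a function
  \<open>nat \<Rightarrow> real\<close> vanishing at the index \<open>0\<close>, which is not used.
\<close>

definition c00 :: "(nat \<Rightarrow> real) set" where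
  "c00 = {x. x 0 = 0 \<and> finite {i. x i \<noteq> 0}}"

definition unit_vec :: "nat \<Rightarrow> nat \<Rightarrow> real" where
  "unit_vec i = (\<lambda>j. if j = i then 1 else 0)"

definition coord_proj :: "nat set \<Rightarrow> (nat \<Rightarrow> real) \<Rightarrow> nat \<Rightarrow> real" where
  "coord_proj E x = (\<lambda>i. if i \<in> E then x i else 0)"

definition schreier :: "nat set set" where
  "schreier = {F. F \<subseteq> {1..} \<and> finite F \<and> F \<noteq> {} \<and> card F \<le> Min F} \<union> {{}}"

text \<open>
  For nonempty sets this is \<open>max E < min F\<close>; in particular it fails if \<open>E\<close> is infinite.
\<close>

definition block_less :: "nat set \<Rightarrow> nat set \<Rightarrow> bool" where
  "block_less E F \<longleftrightarrow> (\<forall>i\<in>E. \<forall>j\<in>F. i < j)"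

text \<open>
  The sets \<open>E i\<close> may be infinite (only the last one can be), so their minimum is written
  \<open>Inf (E i)\<close> rather than \<open>Min (E i)\<close>.
\<close>

definition admissible :: "nat \<Rightarrow> (nat \<Rightarrow> nat set) \<Rightarrow> bool" where
  "admissible d E \<longleftrightarrow>
     1 \<le> d \<and>
     (\<forall>i\<in>{1..d}. E i \<noteq> {} \<and> E i \<subseteq> {1..}) \<and>
     (\<forall>i\<in>{1..<d}. block_less (E i) (E (Suc i))) \<and>
     {Inf (E i) | i. i \<in> {1..d}} \<in> schreier"

primrec tsirelson_step :: "real \<Rightarrow> nat \<Rightarrow> (nat \<Rightarrow> real) \<Rightarrow> real" where
  "tsirelson_step \<theta> 0 x = (SUP i\<in>{1..}. \<bar>x i\<bar>)"
| "tsirelson_step \<theta> (Suc k) x =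
     max (tsirelson_step \<theta> k x)
         (SUP (d, E) \<in> {(d, E). admissible d E}.
            \<theta> * (\<Sum>i=1..d. tsirelson_step \<theta> k (coord_proj (E i) x)))"

definition tsirelson_norm :: "real \<Rightarrow> (nat \<Rightarrow> real) \<Rightarrow> real" where
  "tsirelson_norm \<theta> x = (SUP k. tsirelson_step \<theta> k x)"

text \<open>
  On \<open>c00\<close> the suprema above are suprema of nonempty sets bounded by the \<open>l1\<close>-norm.
\<close>

lemma coord_proj_c00: "x \<in> c00 \<Longrightarrow> coord_proj E x \<in> c00"
proof -
  assume "x \<in> c00"
  moreover have "{i. coord_proj E x i \<noteq> 0} \<subseteq> {i. x i \<noteq> 0}"
    by (auto simp: coord_proj_def)
  ultimately show ?thesis
    by (auto simp: c00_def coord_proj_def intro: finite_subset)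
qed

lemma block_less_lt:
  assumes E: "\<forall>i\<in>{1..d}. E i \<noteq> {}" and b: "\<forall>i\<in>{1..<d}. block_less (E i) (E (Suc i))"
    and ij: "1 \<le> i" "i < j" "j \<le> d" and p: "p \<in> E i" "q \<in> E j"
  shows "p < q"
  using ij(2,3) p(2)
proof (induction j arbitrary: q)
  case (Suc j)
  have step: "block_less (E j) (E (Suc j))" using b Suc.prems ij(1) by auto
  show ?case
  proof (cases "i = j")
    case True
    then show ?thesis using step p(1) Suc.prems by (auto simp: block_less_def)
  next
    case False
    then obtain r where r: "r \<in> E j" using E Suc.prems ij(1) by force
    have "p < r" using Suc.IH[of r] False Suc.prems r by simp
    then show ?thesis using step r Suc.prems by (force simp: block_less_def)
  qed
qed simp

lemma sum_l1_le:
  assumes x: "x \<in> c00" and a: "admissible d E"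
  shows "(\<Sum>i=1..d. \<Sum>j | coord_proj (E i) x j \<noteq> 0. \<bar>coord_proj (E i) x j\<bar>)
           \<le> (\<Sum>j | x j \<noteq> 0. \<bar>x j\<bar>)"
proof -
  let ?S = "{j. x j \<noteq> 0}"
  have fin: "finite ?S" using x by (simp add: c00_def)
  have E: "\<forall>i\<in>{1..d}. E i \<noteq> {}" and b: "\<forall>i\<in>{1..<d}. block_less (E i) (E (Suc i))"
    using a by (auto simp: admissible_def)
  have dj: "E i \<inter> E j = {}" if "i \<in> {1..d}" "j \<in> {1..d}" "i \<noteq> j" for i j
  proof -
    have "p \<noteq> q" if "p \<in> E i" "q \<in> E j" for p q
      using block_less_lt[OF E b, of i j p q] block_less_lt[OF E b, of j i q p]
        that \<open>i \<in> _\<close> \<open>j \<in> _\<close> \<open>i \<noteq> j\<close> by (cases "i < j") auto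
    then show ?thesis by blast
  qed
  have "(\<Sum>j | coord_proj (E i) x j \<noteq> 0. \<bar>coord_proj (E i) x j\<bar>) = (\<Sum>j \<in> ?S \<inter> E i. \<bar>x j\<bar>)" for i
    by (rule sum.cong) (auto simp: coord_proj_def split: if_splits)
  then have "(\<Sum>i=1..d. \<Sum>j | coord_proj (E i) x j \<noteq> 0. \<bar>coord_proj (E i) x j\<bar>)
      = (\<Sum>i=1..d. \<Sum>j \<in> ?S \<inter> E i. \<bar>x j\<bar>)" by simp
  also have "\<dots> = (\<Sum>j \<in> (\<Union>i\<in>{1..d}. ?S \<inter> E i). \<bar>x j\<bar>)"
  proof (rule sum.UNION_disjoint[symmetric])
    show "\<forall>i\<in>{1..d}. \<forall>j\<in>{1..d}. i \<noteq> j \<longrightarrow> ?S \<inter> E i \<inter> (?S \<inter> E j) = {}"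
      using dj by blast
  qed (use fin in auto)
  also have "\<dots> \<le> (\<Sum>j \<in> ?S. \<bar>x j\<bar>)"
    by (rule sum_mono2) (use fin in auto)
  finally show ?thesis .
qed

lemma admissible_singleton: "admissible 1 (\<lambda>_. {1})"
proof -
  have *: "{Inf {1::nat} | i::nat. i \<in> {1..1}} = {1}" by (auto simp: cInf_singleton)
  show ?thesis unfolding admissible_def * by (simp add: schreier_def)
qed

lemma tsirelson_step_le_l1:
  assumes "x \<in> c00" "0 \<le> \<theta>" "\<theta> \<le> 1"
  shows "tsirelson_step \<theta> k x \<le> (\<Sum>j | x j \<noteq> 0. \<bar>x j\<bar>)"
  using assms(1)
proof (induction k arbitrary: x)
  case 0
  then have "\<bar>x i\<bar> \<le> (\<Sum>j | x j \<noteq> 0. \<bar>x j\<bar>)" for i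
    by (cases "x i = 0") (auto simp: c00_def sum_nonneg intro!: member_le_sum)
  then show ?case by (auto intro!: cSUP_least)
next
  case (Suc k)
  have "\<theta> * (\<Sum>i=1..d. tsirelson_step \<theta> k (coord_proj (E i) x)) \<le> (\<Sum>j | x j \<noteq> 0. \<bar>x j\<bar>)"
    if "admissible d E" for d E
  proof -
    have "(\<Sum>i=1..d. tsirelson_step \<theta> k (coord_proj (E i) x)) \<le> (\<Sum>j | x j \<noteq> 0. \<bar>x j\<bar>)"
      by (rule order_trans[OF sum_mono sum_l1_le[OF Suc.prems that]])
        (rule Suc.IH[OF coord_proj_c00[OF Suc.prems]])
    then have "\<theta> * (\<Sum>i=1..d. tsirelson_step \<theta> k (coord_proj (E i) x))
        \<le> \<theta> * (\<Sum>j | x j \<noteq> 0. \<bar>x j\<bar>)"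
      by (rule mult_left_mono) (rule assms)
    also have "\<dots> \<le> (\<Sum>j | x j \<noteq> 0. \<bar>x j\<bar>)"
      by (rule mult_left_le_one_le) (use assms in \<open>auto simp: sum_nonneg\<close>)
    finally show ?thesis .
  qed
  then have "(SUP (d, E) \<in> {(d, E). admissible d E}.
      \<theta> * (\<Sum>i=1..d. tsirelson_step \<theta> k (coord_proj (E i) x))) \<le> (\<Sum>j | x j \<noteq> 0. \<bar>x j\<bar>)"
    using admissible_singleton by (intro cSUP_least) auto
  then show ?case using Suc by simp
qed

lemma tsirelson_suprema_bdd:
  assumes "x \<in> c00" "0 \<le> \<theta>" "\<theta> \<le> 1"
  shows "bdd_above ((\<lambda>i. \<bar>x i\<bar>) ` {1..})"
    and "bdd_above ((\<lambda>(d, E). \<theta> * (\<Sum>i=1..d. tsirelson_step \<theta> k (coord_proj (E i) x)))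
           ` {(d, E). admissible d E})"
    and "bdd_above (range (\<lambda>k. tsirelson_step \<theta> k x))"
proof -
  let ?L = "\<Sum>j | x j \<noteq> 0. \<bar>x j\<bar>"
  have "\<bar>x i\<bar> \<le> ?L" for i
    using assms(1) by (cases "x i = 0") (auto simp: c00_def sum_nonneg intro!: member_le_sum)
  then show "bdd_above ((\<lambda>i. \<bar>x i\<bar>) ` {1..})" by (intro bdd_aboveI2)
  have "\<theta> * (\<Sum>i=1..d. tsirelson_step \<theta> k (coord_proj (E i) x)) \<le> \<theta> * ?L"
    if "admissible d E" for d E
    by (rule mult_left_mono[OF order_trans[OF sum_mono sum_l1_le[OF assms(1) that]] assms(2)])
      (rule tsirelson_step_le_l1[OF coord_proj_c00[OF assms(1)] assms(2,3)])
  then show "bdd_above ((\<lambda>(d, E). \<theta> * (\<Sum>i=1..d. tsirelson_step \<theta> k (coord_proj (E i) x)))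
      ` {(d, E). admissible d E})"
    by (intro bdd_aboveI2[where M = "\<theta> * ?L"]) auto
  show "bdd_above (range (\<lambda>k. tsirelson_step \<theta> k x))"
    by (rule bdd_aboveI2) (rule tsirelson_step_le_l1[OF assms])
qed

text \<open>
  A completion of \<open>c00\<close> under the norm \<open>N\<close> is a Banach space \<open>'a\<close> with a linear map
  \<open>J\<close> from \<open>c00\<close> to \<open>'a\<close> that preserves the norm and has dense range.  It is
  unique up to an isometric isomorphism commuting with the maps \<open>J\<close>.  Since the norm of a type
  is fixed by its class instance, the space is an arbitrary such \<open>'a\<close>, so that the parameter
  \<open>\<theta>\<close> can range over terms.
\<close>

definition is_completion_c00 ::
    "((nat \<Rightarrow> real) \<Rightarrow> real) \<Rightarrow> ((nat \<Rightarrow> real) \<Rightarrow> 'a::banach) \<Rightarrow> bool" where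
  "is_completion_c00 N J \<longleftrightarrow>
     (\<forall>x\<in>c00. \<forall>y\<in>c00. J (\<lambda>i. x i + y i) = J x + J y) \<and>
     (\<forall>a. \<forall>x\<in>c00. J (\<lambda>i. a * x i) = a *\<^sub>R J x) \<and>
     (\<forall>x\<in>c00. norm (J x) = N x) \<and>
     closure (J ` c00) = UNIV"

definition is_tsirelson_space :: "real \<Rightarrow> ((nat \<Rightarrow> real) \<Rightarrow> 'a::banach) \<Rightarrow> bool" where
  "is_tsirelson_space \<theta> J \<longleftrightarrow> is_completion_c00 (tsirelson_norm \<theta>) J"

definition Isom :: "('a::real_normed_vector \<Rightarrow> 'a) set" where
  "Isom = {f. linear f \<and> (\<forall>x. norm (f x) = norm x) \<and> surj f}"

end

theory Submission
  imports Defs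
begin

text \<open>
  Since \<open>\<theta> = 1/n\<close>, admissible families of at most \<open>n\<close> sets do not contribute to the norm, so the
  norm is the maximum of the supremum norm and the norm of the part of the vector beyond \<open>n\<close>; this
  gives the invariance under permutations of \<open>{1..n}\<close>.

  Conversely, let \<open>U\<close> be a linear isometry.  No subsequence of the basis spans \<open>l1\<close>, so the
  coordinates of \<open>U e\<^sub>m\<close> tend to \<open>0\<close>.  Adding to \<open>e\<^sub>i\<close> sufficiently sparse unit vectors,
  \<open>j - 1\<close> of them for \<open>j > max i n\<close>, one compares the norm, which is \<open>(j - 1)/n\<close>, with that of
  the image and finds that the \<open>j\<close>-th coordinate of \<open>U e\<^sub>i\<close> vanishes.  Hence \<open>U\<close> is triangular.
  On the span of \<open>e\<^sub>1, \<dots>, e\<^sub>n\<close>, which carries the supremum norm, it is a signed permutation, and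
  the vectors \<open>e\<^sub>i\<close> with \<open>i > n\<close> are treated one after another: if \<open>U e\<^sub>i = c e\<^sub>i + z\<close>, then the
  norm of \<open>e\<^sub>i + h\<close> does not change when \<open>c z\<close> is added to \<open>h\<close>, so that \<open>z = 0\<close>.
\<close>

section \<open>Vectors of finite support and the Tsirelson norm\<close>

abbreviation l1_norm :: "(nat \<Rightarrow> real) \<Rightarrow> real" where
  "l1_norm x \<equiv> \<Sum>j | x j \<noteq> 0. \<bar>x j\<bar>"

lemma zero_in_c00 [simp]: "(\<lambda>_. 0) \<in> c00"
  by (simp add: c00_def)

lemma add_in_c00: "x \<in> c00 \<Longrightarrow> y \<in> c00 \<Longrightarrow> (\<lambda>i. x i + y i) \<in> c00"
  by (auto simp: c00_def intro: finite_subset[OF _ finite_UnI, of _ "{i. x i \<noteq> 0}" "{i. y i \<noteq> 0}"])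

lemma scale_in_c00: "x \<in> c00 \<Longrightarrow> (\<lambda>i. a * x i) \<in> c00"
  by (auto simp: c00_def intro: finite_subset[of _ "{i. x i \<noteq> 0}"])

lemma unit_vec_in_c00: "1 \<le> i \<Longrightarrow> unit_vec i \<in> c00"
  by (auto simp: c00_def unit_vec_def)

lemma sum_in_c00: "(\<And>k. k \<in> K \<Longrightarrow> f k \<in> c00) \<Longrightarrow> (\<lambda>i. \<Sum>k\<in>K. f k i) \<in> c00"
  by (induction K rule: infinite_finite_induct) (auto intro: add_in_c00)

lemma c00_bounded_support:
  assumes "x \<in> c00"
  obtains p where "\<And>i. i > p \<Longrightarrow> x i = 0"
proof -
  have "finite {i. x i \<noteq> 0}" using assms by (simp add: c00_def)
  then obtain p where "\<forall>i\<in>{i. x i \<noteq> 0}. i \<le> p"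
    by (meson finite_nat_set_iff_bounded_le)
  then show ?thesis using that by (metis linorder_not_less mem_Collect_eq)
qed

lemma in_c00_if_bounded_support: "x 0 = 0 \<Longrightarrow> (\<And>i. i > p \<Longrightarrow> x i = 0) \<Longrightarrow> x \<in> c00"
  by (auto simp: c00_def intro!: finite_subset[of _ "{..p}"]) (meson linorder_not_less)

lemma l1_norm_eq_sum:
  "finite S \<Longrightarrow> {j. x j \<noteq> 0} \<subseteq> S \<Longrightarrow> l1_norm x = (\<Sum>j\<in>S. \<bar>x j\<bar>)"
  by (rule sum.mono_neutral_left) auto

section \<open>Admissible families in terms of their size and their points\<close>

text \<open>Successive blocks have distinct minima, so \<open>d\<close> is the cardinality of the
  set of minima. The Schreier condition bounds it by the least minimum, hence by every point of
  every member.\<close>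

lemma admissible_le:
  assumes "admissible d E" "i \<in> {1..d}" "p \<in> E i"
  shows "d \<le> p"
proof -
  have E: "\<forall>i\<in>{1..d}. E i \<noteq> {}" and b: "\<forall>i\<in>{1..<d}. block_less (E i) (E (Suc i))"
    and F: "{Inf (E i) | i. i \<in> {1..d}} \<in> schreier"
    using assms by (auto simp: admissible_def)
  let ?F = "(\<lambda>i. Inf (E i)) ` {1..d}"
  have inj: "inj_on (\<lambda>i. Inf (E i)) {1..d}"
  proof (rule linorder_inj_onI')
    fix i j assume ij: "i \<in> {1..d}" "j \<in> {1..d}" "i < j"
    show "Inf (E i) \<noteq> Inf (E j)"
      using block_less_lt[OF E b, of i j "Inf (E i)" "Inf (E j)"] ij E Inf_nat_def1
      by (metis atLeastAtMost_iff less_irrefl)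
  qed
  have "?F = {Inf (E i) | i. i \<in> {1..d}}" by auto
  then have "card ?F \<le> Min ?F" using F assms(2) by (force simp: schreier_def)
  then have "d \<le> Min ?F" using inj by (simp add: card_image)
  also have "\<dots> \<le> Inf (E i)" using assms(2) by (intro Min_le) auto
  also have "\<dots> \<le> p" using assms(3) by (simp add: cInf_lower)
  finally show ?thesis .
qed

text \<open>A converse to \<open>admissible_le\<close>: there are at most \<open>d\<close> minima
  and each is at least \<open>d\<close>, which is the Schreier condition.\<close>

lemma admissibleI:
  assumes "1 \<le> d" "\<And>i. i \<in> {1..d} \<Longrightarrow> E i \<noteq> {}" "\<And>i p. i \<in> {1..d} \<Longrightarrow> p \<in> E i \<Longrightarrow> d \<le> p"
    and "\<And>i. i \<in> {1..<d} \<Longrightarrow> block_less (E i) (E (Suc i))"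
  shows "admissible d E"
proof -
  let ?F = "(\<lambda>i. Inf (E i)) ` {1..d}"
  have F: "{Inf (E i) | i. i \<in> {1..d}} = ?F" by auto
  have ge: "d \<le> Inf (E i)" if "i \<in> {1..d}" for i
    using assms(2,3) that Inf_nat_def1 by blast
  have "card ?F \<le> d" using card_image_le[of "{1..d}" "\<lambda>i. Inf (E i)"] by simp
  also have "d \<le> Min ?F" using ge assms(1) by (subst Min_ge_iff) auto
  finally have "?F \<in> schreier" using ge assms(1) by (force simp: schreier_def)
  then show ?thesis unfolding admissible_def F using assms by (force dest: assms(3))
qed

section \<open>The level norms \<open>stepnorm k\<close> and their supremum \<open>N\<close>\<close>

locale tsirelson_parameter =
  fixes \<theta> :: real
  assumes theta_nonneg: "0 \<le> \<theta>" and theta_le_1: "\<theta> \<le> 1"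
begin

abbreviation stepnorm where "stepnorm \<equiv> tsirelson_step \<theta>"
abbreviation N where "N \<equiv> tsirelson_norm \<theta>"

lemma coord_le_step_0: "x \<in> c00 \<Longrightarrow> \<bar>x i\<bar> \<le> stepnorm 0 x"
proof (cases "i \<ge> 1")
  case True
  assume "x \<in> c00"
  then show ?thesis using True
    using cSUP_upper[OF _ tsirelson_suprema_bdd(1)[OF _ theta_nonneg theta_le_1], of i x] by simp
next
  case False
  assume x: "x \<in> c00"
  \<comment> \<open>The supremum runs over positive indices only. At index \<open>0\<close> the
    vector vanishes, so it is enough that the supremum is nonnegative, which index \<open>1\<close>
    shows.\<close>
  then have "\<bar>x 1\<bar> \<le> stepnorm 0 x"
    using cSUP_upper[OF _ tsirelson_suprema_bdd(1)[OF _ theta_nonneg theta_le_1], of 1 x] by simp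
  then show ?thesis using False x by (auto simp: c00_def not_le)
qed

lemma step_0_le: "(\<And>i. i \<ge> 1 \<Longrightarrow> \<bar>x i\<bar> \<le> B) \<Longrightarrow> stepnorm 0 x \<le> B"
  by (auto intro!: cSUP_least)

lemma step_Suc_ge:
  "x \<in> c00 \<Longrightarrow> admissible d E \<Longrightarrow>
    \<theta> * (\<Sum>i=1..d. stepnorm k (coord_proj (E i) x)) \<le> stepnorm (Suc k) x"
  using cSUP_upper[OF _ tsirelson_suprema_bdd(2)[OF _ theta_nonneg theta_le_1, of x k], of "(d, E)"]
  by auto

lemma step_Suc_le:
  assumes "stepnorm k x \<le> B"
    and "\<And>d E. admissible d E \<Longrightarrow> \<theta> * (\<Sum>i=1..d. stepnorm k (coord_proj (E i) x)) \<le> B"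
  shows "stepnorm (Suc k) x \<le> B"
  using assms admissible_singleton by (auto intro!: cSUP_least)

lemma step_mono: "k \<le> l \<Longrightarrow> stepnorm k x \<le> stepnorm l x"
  by (rule lift_Suc_mono_le[of "\<lambda>k. stepnorm k x"]) auto

lemma coord_le_step: "x \<in> c00 \<Longrightarrow> \<bar>x i\<bar> \<le> stepnorm k x"
  using coord_le_step_0[of x i] step_mono[of 0 k x] by linarith

lemma step_nonneg: "x \<in> c00 \<Longrightarrow> 0 \<le> stepnorm k x"
  using coord_le_step[of x 1 k] by linarith

text \<open>Projections preserve the domination of coordinates, so induction on the level applies.
  This is the 1-unconditionality of the basis; signs never matter for the norm.\<close>

lemma step_mono_abs:
  assumes "x \<in> c00" "y \<in> c00" "\<And>i. \<bar>x i\<bar> \<le> \<bar>y i\<bar>"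
  shows "stepnorm k x \<le> stepnorm k y"
  using assms
proof (induction k arbitrary: x y)
  case 0
  then show ?case by (intro step_0_le) (meson coord_le_step_0 order_trans)
next
  case (Suc k)
  show ?case
  proof (rule step_Suc_le)
    show "stepnorm k x \<le> stepnorm (Suc k) y"
      using Suc.IH[OF Suc.prems] step_mono[of k "Suc k" y] by simp
  next
    fix d E assume a: "admissible d E"
    have "stepnorm k (coord_proj (E i) x) \<le> stepnorm k (coord_proj (E i) y)" for i
      using Suc.prems by (intro Suc.IH) (auto intro: coord_proj_c00, auto simp: coord_proj_def)
    then have "\<theta> * (\<Sum>i=1..d. stepnorm k (coord_proj (E i) x))
        \<le> \<theta> * (\<Sum>i=1..d. stepnorm k (coord_proj (E i) y))"
      by (intro mult_left_mono sum_mono theta_nonneg)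
    also have "\<dots> \<le> stepnorm (Suc k) y" by (rule step_Suc_ge[OF Suc.prems(2) a])
    finally show "\<theta> * (\<Sum>i=1..d. stepnorm k (coord_proj (E i) x)) \<le> stepnorm (Suc k) y" .
  qed
qed

lemma step_coord_proj_le: "x \<in> c00 \<Longrightarrow> stepnorm k (coord_proj E x) \<le> stepnorm k x"
  by (rule step_mono_abs) (auto intro: coord_proj_c00, auto simp: coord_proj_def)

lemma step_triangle:
  assumes "x \<in> c00" "y \<in> c00"
  shows "stepnorm k (\<lambda>i. x i + y i) \<le> stepnorm k x + stepnorm k y"
  using assms
proof (induction k arbitrary: x y)
  case 0
  show ?case
  proof (rule step_0_le)
    fix i show "\<bar>x i + y i\<bar> \<le> stepnorm 0 x + stepnorm 0 y"
      using coord_le_step_0[OF 0(1), of i] coord_le_step_0[OF 0(2), of i] by linarith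
  qed
next
  case (Suc k)
  show ?case
  proof (rule step_Suc_le)
    show "stepnorm k (\<lambda>i. x i + y i) \<le> stepnorm (Suc k) x + stepnorm (Suc k) y"
      using Suc.IH[OF Suc.prems] step_mono[of k "Suc k" y] step_mono[of k "Suc k" x] by simp
  next
    fix d E assume a: "admissible d E"
    have "coord_proj (E i) (\<lambda>i. x i + y i) = (\<lambda>j. coord_proj (E i) x j + coord_proj (E i) y j)" for i
      by (auto simp: coord_proj_def)
    then have "\<theta> * (\<Sum>i=1..d. stepnorm k (coord_proj (E i) (\<lambda>i. x i + y i)))
        \<le> \<theta> * (\<Sum>i=1..d. stepnorm k (coord_proj (E i) x) + stepnorm k (coord_proj (E i) y))"
      using Suc by (intro mult_left_mono sum_mono theta_nonneg) (auto intro: coord_proj_c00)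
    also have "\<dots> \<le> stepnorm (Suc k) x + stepnorm (Suc k) y"
      using step_Suc_ge[OF Suc.prems(1) a, of k] step_Suc_ge[OF Suc.prems(2) a, of k]
      by (simp add: sum.distrib distrib_left)
    finally show "\<theta> * (\<Sum>i=1..d. stepnorm k (coord_proj (E i) (\<lambda>i. x i + y i)))
        \<le> stepnorm (Suc k) x + stepnorm (Suc k) y" .
  qed
qed

lemma step_scale_le:
  assumes "x \<in> c00"
  shows "stepnorm k (\<lambda>i. a * x i) \<le> \<bar>a\<bar> * stepnorm k x"
  using assms
proof (induction k arbitrary: x)
  case 0
  then show ?case
    by (intro step_0_le) (simp only: abs_mult, intro mult_left_mono coord_le_step_0, auto)
next
  case (Suc k)
  show ?case
  proof (rule step_Suc_le)
    show "stepnorm k (\<lambda>i. a * x i) \<le> \<bar>a\<bar> * stepnorm (Suc k) x"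
      using Suc.IH[OF Suc.prems] mult_left_mono[OF step_mono[of k "Suc k" x], of "\<bar>a\<bar>"] by simp
  next
    fix d E assume a: "admissible d E"
    have "coord_proj (E i) (\<lambda>i. a * x i) = (\<lambda>j. a * coord_proj (E i) x j)" for i
      by (auto simp: coord_proj_def)
    then have "\<theta> * (\<Sum>i=1..d. stepnorm k (coord_proj (E i) (\<lambda>i. a * x i)))
        \<le> \<theta> * (\<Sum>i=1..d. \<bar>a\<bar> * stepnorm k (coord_proj (E i) x))"
      using Suc by (intro mult_left_mono sum_mono theta_nonneg) (auto intro: coord_proj_c00)
    also have "\<dots> \<le> \<bar>a\<bar> * stepnorm (Suc k) x"
      using mult_left_mono[OF step_Suc_ge[OF Suc.prems(1) a, of k], of "\<bar>a\<bar>"]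
      by (simp add: sum_distrib_left algebra_simps)
    finally show "\<theta> * (\<Sum>i=1..d. stepnorm k (coord_proj (E i) (\<lambda>i. a * x i)))
        \<le> \<bar>a\<bar> * stepnorm (Suc k) x" .
  qed
qed

lemma step_le_norm: "x \<in> c00 \<Longrightarrow> stepnorm k x \<le> N x"
  unfolding tsirelson_norm_def
  by (rule cSUP_upper) (auto intro: tsirelson_suprema_bdd(3) theta_nonneg theta_le_1)

lemma norm_le: "(\<And>k. stepnorm k x \<le> B) \<Longrightarrow> N x \<le> B"
  unfolding tsirelson_norm_def by (rule cSUP_least) auto

lemma coord_le_norm: "x \<in> c00 \<Longrightarrow> \<bar>x i\<bar> \<le> N x"
  using coord_le_step[of x i 0] step_le_norm[of x 0] by linarith

lemma norm_mono_abs: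
  assumes "x \<in> c00" "y \<in> c00" "\<And>i. \<bar>x i\<bar> \<le> \<bar>y i\<bar>"
  shows "N x \<le> N y"
  using step_mono_abs[OF assms] step_le_norm[OF assms(2)] by (meson norm_le order_trans)

lemma norm_cong_abs:
  "x \<in> c00 \<Longrightarrow> y \<in> c00 \<Longrightarrow> (\<And>i. \<bar>x i\<bar> = \<bar>y i\<bar>) \<Longrightarrow> N x = N y"
  by (intro antisym norm_mono_abs) auto

lemma norm_le_l1: "x \<in> c00 \<Longrightarrow> N x \<le> l1_norm x"
  by (intro norm_le tsirelson_step_le_l1 theta_nonneg theta_le_1)

lemma step_tendsto_norm:
  assumes "x \<in> c00"
  shows "(\<lambda>k. stepnorm k x) \<longlonglongrightarrow> N x"
  unfolding tsirelson_norm_def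
proof (rule LIMSEQ_incseq_SUP)
  show "bdd_above (range (\<lambda>k. stepnorm k x))"
    using assms by (intro tsirelson_suprema_bdd(3) theta_nonneg theta_le_1)
qed (auto simp: incseq_def intro: step_mono)

text \<open>One half of the implicit Tsirelson equation. Level \<open>k\<close> on the blocks is
  controlled by level \<open>k + 1\<close> on the whole vector, and a finite sum passes to the limit
  in \<open>k\<close>.\<close>

lemma norm_admissible_ge:
  assumes x: "x \<in> c00" and a: "admissible d E"
  shows "\<theta> * (\<Sum>i=1..d. N (coord_proj (E i) x)) \<le> N x"
proof (rule LIMSEQ_le_const2)
  show "(\<lambda>k. \<theta> * (\<Sum>i=1..d. stepnorm k (coord_proj (E i) x)))
      \<longlonglongrightarrow> \<theta> * (\<Sum>i=1..d. N (coord_proj (E i) x))"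
    using x by (intro tendsto_intros step_tendsto_norm coord_proj_c00)
  show "\<exists>K. \<forall>k\<ge>K. \<theta> * (\<Sum>i=1..d. stepnorm k (coord_proj (E i) x)) \<le> N x"
    using step_Suc_ge[OF x a] step_le_norm[OF x] order_trans by blast
qed

lemma step_sum_le_l1:
  assumes x: "x \<in> c00" and a: "admissible d E"
  shows "(\<Sum>i=1..d. stepnorm k (coord_proj (E i) x)) \<le> l1_norm x"
  by (rule order_trans[OF sum_mono sum_l1_le[OF x a]])
    (rule tsirelson_step_le_l1[OF coord_proj_c00[OF x] theta_nonneg theta_le_1])

text \<open>Every unfolding of an admissible family costs a factor \<open>\<theta>\<close>, so what
  the levels beyond \<open>k\<close> can add is at most the l1 norm after \<open>k + 1\<close>
  unfoldings. A vector of bounded l1 norm with small level norm for a large \<open>k\<close>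
  therefore has small norm, provided \<open>\<theta> < 1\<close>.\<close>

lemma norm_le_l1_step:
  assumes "x \<in> c00"
  shows "N x \<le> \<theta> ^ Suc k * l1_norm x + stepnorm k x"
proof (rule norm_le)
  have pos: "0 \<le> \<theta> ^ k * l1_norm y" for k y
    using theta_nonneg by (simp add: sum_nonneg)
  fix l
  show "stepnorm l x \<le> \<theta> ^ Suc k * l1_norm x + stepnorm k x"
    using assms
  proof (induction l arbitrary: k x)
    case 0
    then show ?case using pos[of "Suc k" x] step_mono[of 0 k x] by linarith
  next
    case (Suc l)
    show ?case
    proof (rule step_Suc_le)
      fix d E assume a: "admissible d E"
      show "\<theta> * (\<Sum>i=1..d. stepnorm l (coord_proj (E i) x)) \<le> \<theta> ^ Suc k * l1_norm x + stepnorm k x"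
      proof (cases k)
        case 0
        have "\<theta> * (\<Sum>i=1..d. stepnorm l (coord_proj (E i) x)) \<le> \<theta> * l1_norm x"
          using step_sum_le_l1[OF Suc.prems a] theta_nonneg by (rule mult_left_mono)
        then show ?thesis using 0 step_nonneg[OF Suc.prems, of 0] by simp
      next
        case (Suc k')
        have "(\<Sum>i=1..d. stepnorm l (coord_proj (E i) x))
            \<le> (\<Sum>i=1..d. \<theta> ^ k * l1_norm (coord_proj (E i) x) + stepnorm k' (coord_proj (E i) x))"
          using Suc.IH[of _ k'] Suc Suc.prems by (intro sum_mono) (auto intro: coord_proj_c00)
        also have "\<dots> \<le> \<theta> ^ k * l1_norm x + (\<Sum>i=1..d. stepnorm k' (coord_proj (E i) x))"
          using mult_left_mono[OF sum_l1_le[OF Suc.prems a], of "\<theta> ^ k"] theta_nonneg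
          by (simp add: sum.distrib sum_distrib_left)
        finally have "\<theta> * (\<Sum>i=1..d. stepnorm l (coord_proj (E i) x))
            \<le> \<theta> * (\<theta> ^ k * l1_norm x + (\<Sum>i=1..d. stepnorm k' (coord_proj (E i) x)))"
          using theta_nonneg by (rule mult_left_mono)
        then show ?thesis
          using step_Suc_ge[OF Suc.prems a, of k'] \<open>k = Suc k'\<close> by (simp add: distrib_left mult.assoc)
      qed
    qed (rule Suc.IH[OF Suc.prems])
  qed
qed

text \<open>
  In the step, blocks \<open>x\<close> with \<open>stepnorm k x\<close> small are added one after another: an admissible
  family that meets the earlier blocks has at most \<open>p\<close> members, where \<open>p\<close> bounds their support.
\<close>

lemma small_step_vector:
  assumes "infinite M" "\<epsilon> > 0"
  shows "\<exists>x\<in>c00. (\<forall>i. x i \<ge> 0) \<and> {i. x i \<noteq> 0} \<subseteq> M \<and> l1_norm x = 1 \<and> stepnorm k x \<le> \<epsilon>"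
  using assms
proof (induction k arbitrary: M \<epsilon>)
  case 0
  obtain m :: nat where m: "m > 0" "1 / real m < \<epsilon>"
    using 0(2) by (metis nat_approx_posE of_nat_Suc zero_less_Suc)
  have "infinite (M - {0})" using 0 by simp
  then obtain S where S: "S \<subseteq> M - {0}" "finite S" "card S = m"
    using infinite_arbitrarily_large by blast
  let ?x = "\<lambda>i. if i \<in> S then 1 / real m else 0"
  have supp: "{i. ?x i \<noteq> 0} = S" using m by auto
  have "l1_norm ?x = 1" using m S(3) unfolding supp by (simp add: S)
  moreover have "stepnorm 0 ?x \<le> \<epsilon>" using m 0(2) by (intro step_0_le) auto
  moreover have "?x \<in> c00" unfolding c00_def using S supp by auto
  ultimately show ?case using S m by (intro bexI[of _ ?x]) auto
next
  case (Suc k)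
  note IH = Suc.IH
  \<comment> \<open>Sums of \<open>r\<close> blocks before normalisation: the l1 norm grows by 1
    with each block, the level norm only by \<open>\<epsilon> / 2\<close>. The constant 1 accounts
    for the families that miss all earlier blocks.\<close>
  have ex: "\<exists>y\<in>c00. (\<forall>i. y i \<ge> 0) \<and> {i. y i \<noteq> 0} \<subseteq> M \<and> l1_norm y = real r
      \<and> stepnorm (Suc k) y \<le> 1 + real r * (\<epsilon> / 2)" for r
  proof (induction r)
    case 0
    have "stepnorm (Suc k) (\<lambda>_. 0) \<le> 0"
      using tsirelson_step_le_l1[OF zero_in_c00 theta_nonneg theta_le_1, of "Suc k"]
      by (simp del: tsirelson_step.simps)
    then show ?case by (intro bexI[of _ "\<lambda>_. 0"]) (auto simp del: tsirelson_step.simps)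
  next
    case (Suc r)
    then obtain y where y: "y \<in> c00" "\<And>i. y i \<ge> 0" "{i. y i \<noteq> 0} \<subseteq> M" "l1_norm y = real r"
      "stepnorm (Suc k) y \<le> 1 + real r * (\<epsilon> / 2)" by blast
    obtain p0 where p0: "\<And>i. i > p0 \<Longrightarrow> y i = 0" using c00_bounded_support[OF y(1)] by blast
    define p where "p = Suc p0"
    have p: "p \<ge> 1" "\<And>i. i > p \<Longrightarrow> y i = 0" using p0 by (auto simp: p_def)
    \<comment> \<open>With this tolerance, up to \<open>p\<close> members of a family gain at most
      \<open>\<epsilon> / 2\<close> in total from the new block. Taking \<open>p\<close> as a
      successor keeps the quotient meaningful.\<close>
    have "infinite (M - {..p})" "\<epsilon> / (2 * real p) > 0"
      using \<open>infinite M\<close> \<open>\<epsilon> > 0\<close> p by auto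
    then obtain x where x: "x \<in> c00" "\<And>i. x i \<ge> 0" "{i. x i \<noteq> 0} \<subseteq> M - {..p}" "l1_norm x = 1"
      "stepnorm k x \<le> \<epsilon> / (2 * real p)"
      using IH[of "M - {..p}" "\<epsilon> / (2 * real p)"] by blast
    let ?z = "\<lambda>i. y i + x i"
    have fin: "finite {i. y i \<noteq> 0}" "finite {i. x i \<noteq> 0}" using x y by (auto simp: c00_def)
    have yx: "y i = 0 \<or> x i = 0" for i using p(2)[of i] x(3) by (cases "i > p") auto
    then have disj: "{i. y i \<noteq> 0} \<inter> {i. x i \<noteq> 0} = {}" by auto
    have "{i. ?z i \<noteq> 0} = {i. y i \<noteq> 0} \<union> {i. x i \<noteq> 0}"
      using x(2) y(2) by (auto simp: add_nonneg_eq_0_iff)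
    then have "l1_norm ?z = (\<Sum>j | y j \<noteq> 0. \<bar>?z j\<bar>) + (\<Sum>j | x j \<noteq> 0. \<bar>?z j\<bar>)"
      using fin disj by (simp add: sum.union_disjoint)
    also have "(\<Sum>j | y j \<noteq> 0. \<bar>?z j\<bar>) = l1_norm y" using disj by (intro sum.cong) auto
    also have "(\<Sum>j | x j \<noteq> 0. \<bar>?z j\<bar>) = l1_norm x"
      using yx by (intro sum.cong[OF refl]) (metis (mono_tags) add_0 mem_Collect_eq)
    finally have l1: "l1_norm ?z = real (Suc r)" using x y by simp
    have xs: "real p * stepnorm k x \<le> \<epsilon> / 2" using x(5) p(1) by (simp add: field_simps)
    have pos: "0 \<le> stepnorm k x" by (rule step_nonneg[OF x(1)])
    have xs': "stepnorm k x \<le> \<epsilon> / 2"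
      using xs mult_right_mono[OF _ pos, of 1 "real p"] p(1) by simp
    have rS: "1 + real (Suc r) * (\<epsilon> / 2) = (1 + real r * (\<epsilon> / 2)) + \<epsilon> / 2"
      by (simp add: algebra_simps)
    have "stepnorm (Suc k) ?z \<le> 1 + real (Suc r) * (\<epsilon> / 2)"
    proof (rule step_Suc_le)
      show "stepnorm k ?z \<le> 1 + real (Suc r) * (\<epsilon> / 2)"
        using step_triangle[OF y(1) x(1), of k] step_mono[of k "Suc k" y] y(5) xs' rS by linarith
    next
      fix d E assume a: "admissible d E"
      show "\<theta> * (\<Sum>i=1..d. stepnorm k (coord_proj (E i) ?z)) \<le> 1 + real (Suc r) * (\<epsilon> / 2)"
      proof (cases "\<exists>i\<in>{1..d}. \<exists>q\<in>E i. q \<le> p")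
        case True
        then have "d \<le> p" using admissible_le[OF a] by fastforce
        have "(\<Sum>i=1..d. stepnorm k (coord_proj (E i) x)) \<le> (\<Sum>i=1..d. stepnorm k x)"
          by (intro sum_mono step_coord_proj_le x)
        also have "\<dots> \<le> real p * stepnorm k x"
          using \<open>d \<le> p\<close> pos by (simp add: mult_right_mono)
        finally have 1: "(\<Sum>i=1..d. stepnorm k (coord_proj (E i) x)) \<le> \<epsilon> / 2" using xs by linarith
        have 2: "0 \<le> (\<Sum>i=1..d. stepnorm k (coord_proj (E i) x))"
          by (intro sum_nonneg step_nonneg coord_proj_c00 x)
        have 3: "\<theta> * (\<Sum>i=1..d. stepnorm k (coord_proj (E i) x)) \<le> \<epsilon> / 2"
          using mult_right_mono[OF theta_le_1 2] 1 by simp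
        have "coord_proj (E i) ?z = (\<lambda>j. coord_proj (E i) y j + coord_proj (E i) x j)" for i
          by (auto simp: coord_proj_def)
        then have "\<theta> * (\<Sum>i=1..d. stepnorm k (coord_proj (E i) ?z))
          \<le> \<theta> * (\<Sum>i=1..d. stepnorm k (coord_proj (E i) y) + stepnorm k (coord_proj (E i) x))"
          using x y by (intro mult_left_mono sum_mono theta_nonneg) (auto intro!: coord_proj_c00 step_triangle)
        also have "\<dots> \<le> stepnorm (Suc k) y + \<epsilon> / 2"
          using step_Suc_ge[OF y(1) a, of k] 3 by (simp add: sum.distrib distrib_left)
        finally show ?thesis using y(5) rS by linarith
      next
        case False
        then have "coord_proj (E i) ?z = coord_proj (E i) x" if "i \<in> {1..d}" for i
          using that p(2) by (force simp: coord_proj_def)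
        then have "\<theta> * (\<Sum>i=1..d. stepnorm k (coord_proj (E i) ?z))
          = \<theta> * (\<Sum>i=1..d. stepnorm k (coord_proj (E i) x))" by simp
        also have "\<dots> \<le> 1 * 1"
          using step_sum_le_l1[OF x(1) a, of k] x(4)
          by (intro mult_mono theta_le_1) (auto intro!: sum_nonneg step_nonneg coord_proj_c00 x)
        finally have *: "\<theta> * (\<Sum>i=1..d. stepnorm k (coord_proj (E i) ?z)) \<le> 1" by simp
        have "0 \<le> real (Suc r) * (\<epsilon> / 2)" using \<open>\<epsilon> > 0\<close> by simp
        with * show ?thesis by linarith
      qed
    qed
    moreover have "?z \<in> c00" using x y by (intro add_in_c00)
    moreover have "{i. ?z i \<noteq> 0} \<subseteq> {i. y i \<noteq> 0} \<union> {i. x i \<noteq> 0}" by auto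
    then have "{i. ?z i \<noteq> 0} \<subseteq> M" using x(3) y(3) by blast
    ultimately show ?case using l1 x(2) y(2) by (intro bexI[of _ ?z]) (auto simp del: tsirelson_step.simps)
  qed
  \<comment> \<open>Dividing the sum of \<open>r\<close> blocks by \<open>r\<close> leaves a level
    norm of at most \<open>1 / r + \<epsilon> / 2\<close>.\<close>
  obtain r :: nat where r: "r > 0" "1 / real r < \<epsilon> / 2"
    using Suc.prems(2) by (metis half_gt_zero nat_approx_posE of_nat_Suc zero_less_Suc)
  obtain y where y: "y \<in> c00" "\<And>i. y i \<ge> 0" "{i. y i \<noteq> 0} \<subseteq> M" "l1_norm y = real r"
      "stepnorm (Suc k) y \<le> 1 + real r * (\<epsilon> / 2)" using ex[of r] by blast
  let ?x = "\<lambda>i. (1 / real r) * y i"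
  have supp: "{i. ?x i \<noteq> 0} = {i. y i \<noteq> 0}" using r by auto
  have "l1_norm ?x = (1 / real r) * l1_norm y"
    unfolding supp by (simp add: abs_mult sum_divide_distrib)
  then have "l1_norm ?x = 1" using r y by simp
  moreover have "stepnorm (Suc k) ?x \<le> \<epsilon>"
  proof -
    have "stepnorm (Suc k) ?x \<le> (1 / real r) * stepnorm (Suc k) y"
      using step_scale_le[OF y(1), of "Suc k" "1 / real r"] by simp
    also have "\<dots> \<le> (1 / real r) * (1 + real r * (\<epsilon> / 2))"
      using y(5) by (intro mult_left_mono) auto
    also have "\<dots> \<le> \<epsilon>" using r by (simp add: field_simps)
    finally show ?thesis .
  qed
  moreover have "?x \<in> c00" using y(1) by (rule scale_in_c00)
  ultimately show ?case using y supp by (intro bexI[of _ ?x]) (auto simp del: tsirelson_step.simps)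
qed

end

section \<open>The parameter \<open>1/n\<close>\<close>

lemma indicator_in_c00: "finite A \<Longrightarrow> 0 \<notin> A \<Longrightarrow> indicator A \<in> c00"
  by (auto simp: c00_def indicator_def)

lemma l1_norm_indicator: "l1_norm (indicator A) = real (card A)"
  by (simp add: indicator_def)

lemma coord_proj_indicator: "coord_proj E (indicator A) = indicator (A \<inter> E)"
  by (auto simp: coord_proj_def indicator_def)

lemma unit_vec_eq_indicator: "unit_vec i = indicator {i}"
  by (auto simp: unit_vec_def indicator_def)

lemma coord_proj_eq_0: "(\<And>i. i \<in> E \<Longrightarrow> x i = 0) \<Longrightarrow> coord_proj E x = (\<lambda>_. 0)"
  by (auto simp: coord_proj_def)

lemma admissible_pairwise_disjoint:
  assumes "admissible d E" "i \<in> {1..d}" "j \<in> {1..d}" "i \<noteq> j"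
  shows "E i \<inter> E j = {}"
proof -
  have E: "\<forall>i\<in>{1..d}. E i \<noteq> {}" and b: "\<forall>i\<in>{1..<d}. block_less (E i) (E (Suc i))"
    using assms(1) by (auto simp: admissible_def)
  have "p \<noteq> q" if "p \<in> E i" "q \<in> E j" for p q
    using block_less_lt[OF E b, of i j p q] block_less_lt[OF E b, of j i q p] that assms(2-4)
    by (cases "i < j") auto
  then show ?thesis by blast
qed

locale tsirelson_reciprocal =
  fixes n :: nat
  assumes n_ge_2: "2 \<le> n"

sublocale tsirelson_reciprocal \<subseteq> tsirelson_parameter "1 / real n"
  using n_ge_2 by unfold_locales auto

context tsirelson_reciprocal
begin

section \<open>Invariance of the norm under signed permutations of the first \<open>n\<close>
  coordinates\<close>

lemma norm_zero: "N (\<lambda>_. 0) = 0"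
  using norm_le_l1[OF zero_in_c00] coord_le_norm[OF zero_in_c00] by force

text \<open>
  An admissible family with at most \<open>n\<close> members contributes an average of norms of projections,
  hence nothing new; all others live beyond \<open>n\<close>.
\<close>

lemma norm_le_sup_tail:
  assumes x: "x \<in> c00" and B: "\<And>i. \<bar>x i\<bar> \<le> B" "N (coord_proj {n<..} x) \<le> B"
  shows "N x \<le> B"
proof (rule norm_le)
  fix k show "stepnorm k x \<le> B"
  proof (induction k)
    case 0
    show ?case by (rule step_0_le) (rule B)
  next
    case (Suc k)
    show ?case
    proof (rule step_Suc_le[OF Suc])
      fix d E assume a: "admissible d E"
      show "1 / real n * (\<Sum>i=1..d. stepnorm k (coord_proj (E i) x)) \<le> B"
      proof (cases "d \<le> n")
        case True
        have "(\<Sum>i=1..d. stepnorm k (coord_proj (E i) x)) \<le> (\<Sum>i=1..d. B)"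
          using step_coord_proj_le[OF x] Suc by (intro sum_mono) (meson order_trans)
        also have "\<dots> \<le> real n * B"
          using True B(1)[of 0] by (auto intro: mult_right_mono)
        finally show ?thesis using n_ge_2 by (simp add: field_simps)
      next
        case False
        have "coord_proj (E i) x = coord_proj (E i) (coord_proj {n<..} x)" if "i \<in> {1..d}" for i
          using admissible_le[OF a that] False by (force simp: coord_proj_def)
        then have "1 / real n * (\<Sum>i=1..d. stepnorm k (coord_proj (E i) x))
            = 1 / real n * (\<Sum>i=1..d. stepnorm k (coord_proj (E i) (coord_proj {n<..} x)))" by simp
        also have "\<dots> \<le> stepnorm (Suc k) (coord_proj {n<..} x)"
          by (rule step_Suc_ge[OF coord_proj_c00[OF x] a])
        also have "\<dots> \<le> B"
          using step_le_norm[OF coord_proj_c00[OF x]] B(2) by (rule order_trans)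
        finally show ?thesis .
      qed
    qed
  qed
qed

text \<open>With no tail beyond \<open>n\<close>, only the supremum norm is left: the first
  \<open>n\<close> unit vectors span a copy of the finite-dimensional supremum-norm space.\<close>

lemma norm_le_sup:
  assumes "x \<in> c00" "\<And>i. i > n \<Longrightarrow> x i = 0" "\<And>i. \<bar>x i\<bar> \<le> B"
  shows "N x \<le> B"
proof (rule norm_le_sup_tail)
  have "coord_proj {n<..} x = (\<lambda>_. 0)" using assms(2) by (intro coord_proj_eq_0) auto
  then show "N (coord_proj {n<..} x) \<le> B" using assms(3)[of 0] norm_zero by simp
qed (use assms in auto)

lemma norm_coord_proj_le: "x \<in> c00 \<Longrightarrow> N (coord_proj E x) \<le> N x"
  by (rule norm_mono_abs) (auto intro: coord_proj_c00, auto simp: coord_proj_def)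

text \<open>Such a permutation, with arbitrary signs, changes neither the largest modulus of a
  coordinate nor the moduli beyond \<open>n\<close>, the only data that
  \<open>norm_le_sup_tail\<close> uses.\<close>

lemma norm_permute_le:
  assumes "x \<in> c00" "y \<in> c00" "\<pi> permutes {1..n}" "\<And>i. \<bar>y (\<pi> i)\<bar> = \<bar>x i\<bar>"
  shows "N y \<le> N x"
proof (rule norm_le_sup_tail[OF assms(2)])
  fix i show "\<bar>y i\<bar> \<le> N x"
    using assms(4)[of "inv \<pi> i"] permutes_inverses(1)[OF assms(3)] coord_le_norm[OF assms(1)]
    by metis
  have "\<bar>y i\<bar> = \<bar>x i\<bar>" if "i > n" for i
    using assms(4)[of i] permutes_not_in[OF assms(3)] that by simp
  then have "N (coord_proj {n<..} y) = N (coord_proj {n<..} x)"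
    by (intro norm_cong_abs coord_proj_c00 assms) (auto simp: coord_proj_def)
  then show "N (coord_proj {n<..} y) \<le> N x" using norm_coord_proj_le[OF assms(1)] by simp
qed

lemma norm_permute:
  assumes "x \<in> c00" "y \<in> c00" "\<pi> permutes {1..n}" "\<And>i. \<bar>y (\<pi> i)\<bar> = \<bar>x i\<bar>"
  shows "N y = N x"
proof (rule antisym)
  have "\<bar>x (inv \<pi> i)\<bar> = \<bar>y i\<bar>" for i
    using assms(4)[of "inv \<pi> i"] permutes_inverses(1)[OF assms(3)] by simp
  then show "N x \<le> N y"
    using norm_permute_le[OF assms(2,1) permutes_inv[OF assms(3)]] by simp
qed (rule norm_permute_le[OF assms])

section \<open>Norms of indicators and of sums of successive blocks\<close>

lemma step_indicator_le_max:
  assumes "finite A" "0 \<notin> A"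
  shows "stepnorm k (indicator A) \<le> max 1 (real (card A) / real n)"
proof (induction k)
  case 0
  show ?case by (rule step_0_le) (auto simp: indicator_def)
next
  case (Suc k)
  show ?case
  proof (rule step_Suc_le[OF Suc])
    fix d E assume a: "admissible d E"
    show "1 / real n * (\<Sum>i=1..d. stepnorm k (coord_proj (E i) (indicator A)))
        \<le> max 1 (real (card A) / real n)"
      using step_sum_le_l1[OF indicator_in_c00[OF assms] a, of k] n_ge_2
      unfolding l1_norm_indicator by (simp add: field_simps max_def)
  qed
qed

lemma step_indicator_le_card:
  assumes "finite A" "0 \<notin> A"
  shows "stepnorm k (indicator A) \<le> real (card A)"
  using tsirelson_step_le_l1[OF indicator_in_c00[OF assms] theta_nonneg theta_le_1, of k]
  unfolding l1_norm_indicator .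

text \<open>For at least two points and \<open>n \<ge> 2\<close>, both 1 and
  \<open>card A / n\<close> are at most \<open>card A - 1\<close>. This is the loss suffered by a
  member that contains two points.\<close>

lemma step_indicator_less_card:
  assumes "finite A" "0 \<notin> A" "2 \<le> card A"
  shows "stepnorm k (indicator A) \<le> real (card A) - 1"
proof -
  have "real (card A) / real n \<le> real (card A) / 2"
    using n_ge_2 by (intro divide_left_mono) auto
  then have "max 1 (real (card A) / real n) \<le> real (card A) - 1"
    using assms(3) by (intro max.boundedI) linarith+
  then show ?thesis using step_indicator_le_max[OF assms(1,2), of k] by linarith
qed

text \<open>
  The family has at most \<open>i \<le> card S\<close> members if it meets \<open>i\<close>, so if it also
  covers \<open>S\<close> then one of its members contains two of the \<open>card S + 1\<close> points, which
  costs at least \<open>1\<close>.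
\<close>

lemma norm_indicator_insert_le:
  assumes S: "finite S" "\<And>s. s \<in> S \<Longrightarrow> i < s" and i: "1 \<le> i" "i \<le> card S" and n: "n \<le> card S"
  shows "N (indicator (insert i S)) \<le> real (card S) / real n"
proof (rule norm_le)
  fix k
  let ?A = "insert i S"
  have A: "finite ?A" "0 \<notin> ?A" "card ?A = Suc (card S)" using S i by force+
  show "stepnorm k (indicator ?A) \<le> real (card S) / real n"
  proof (induction k)
    case 0
    have "1 \<le> real (card S) / real n" using n n_ge_2 by simp
    then show ?case by (intro step_0_le) (auto simp: indicator_def)
  next
    case (Suc k)
    show ?case
    proof (rule step_Suc_le[OF Suc])
      fix d E assume a: "admissible d E"
      let ?c = "\<lambda>j. card (?A \<inter> E j)"
      let ?f = "\<lambda>j. stepnorm k (indicator (?A \<inter> E j))"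
      have f: "?f j \<le> real (?c j)" "2 \<le> ?c j \<Longrightarrow> ?f j \<le> real (?c j) - 1" for j
        using step_indicator_le_card[of "?A \<inter> E j" k] step_indicator_less_card[of "?A \<inter> E j" k] A
        by auto
      have cU: "(\<Sum>j=1..d. ?c j) = card (\<Union>j\<in>{1..d}. ?A \<inter> E j)"
        using admissible_pairwise_disjoint[OF a] A(1) by (intro card_UN_disjoint[symmetric]) blast+
      have U: "(\<Union>j\<in>{1..d}. ?A \<inter> E j) \<subseteq> ?A" by auto
      have le: "(\<Sum>j=1..d. ?c j) \<le> Suc (card S)"
        unfolding cU using card_mono[OF A(1) U] A(3) by simp
      have "(\<Sum>j=1..d. ?f j) \<le> real (card S)"
      proof (cases "\<exists>j0\<in>{1..d}. 2 \<le> ?c j0")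
        case True
        then obtain j0 where j0: "j0 \<in> {1..d}" "2 \<le> ?c j0" by blast
        have "(\<Sum>j=1..d. ?f j) = ?f j0 + (\<Sum>j\<in>{1..d} - {j0}. ?f j)"
          using j0 by (intro sum.remove) auto
        also have "\<dots> \<le> (real (?c j0) - 1) + (\<Sum>j\<in>{1..d} - {j0}. real (?c j))"
          using f j0 by (intro add_mono sum_mono) auto
        also have "\<dots> = (\<Sum>j=1..d. real (?c j)) - 1"
          using j0 by (subst sum.remove[of "{1..d}" j0]) auto
        also have "\<dots> = real (\<Sum>j=1..d. ?c j) - 1" by simp
        also have "\<dots> \<le> real (card S)" using le by linarith
        finally show ?thesis .
      next
        case False
        have "(\<Sum>j=1..d. ?c j) \<le> card S"
        proof (cases "\<exists>j\<in>{1..d}. i \<in> E j")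
          case True
          then have "d \<le> i" using admissible_le[OF a] by blast
          have "(\<Sum>j=1..d. ?c j) \<le> (\<Sum>j=1..d. 1)"
            using False by (intro sum_mono) force
          then show ?thesis using \<open>d \<le> i\<close> i by simp
        next
          case False
          then have "(\<Union>j\<in>{1..d}. ?A \<inter> E j) \<subseteq> S" by auto
          then show ?thesis unfolding cU using S(1) by (rule card_mono[rotated])
        qed
        moreover have "(\<Sum>j=1..d. ?f j) \<le> (\<Sum>j=1..d. real (?c j))"
          by (intro sum_mono f)
        moreover have "(\<Sum>j=1..d. real (?c j)) = real (\<Sum>j=1..d. ?c j)" by simp
        ultimately show ?thesis by linarith
      qed
      then show "1 / real n * (\<Sum>j=1..d. stepnorm k (coord_proj (E j) (indicator ?A)))
          \<le> real (card S) / real n"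
        unfolding coord_proj_indicator by (simp add: divide_right_mono)
    qed
  qed
qed

text \<open>The singleton \<open>{j}\<close> and the ranges of the \<open>r\<close> blocks are
  \<open>j = r + 1\<close> successive sets whose points are all at least \<open>j\<close>. They form
  an admissible family, and \<open>norm_admissible_ge\<close> applies.\<close>

lemma norm_blocks_ge:
  fixes z :: "nat \<Rightarrow> nat \<Rightarrow> real" and p :: "nat \<Rightarrow> nat"
  assumes x: "x \<in> c00" "\<And>i. i > p 0 \<Longrightarrow> x i = 0" and j: "1 \<le> j" "j \<le> p 0" "j = Suc r"
    and z: "\<And>k. z k \<in> c00" "\<And>k i. z k i \<noteq> 0 \<Longrightarrow> p k < i \<and> i \<le> p (Suc k)"
    and p: "strict_mono p"
  shows "(\<bar>x j\<bar> + (\<Sum>k<r. N (z k))) / real n \<le> N (\<lambda>i. x i + (\<Sum>k<r. z k i))"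
proof -
  \<comment> \<open>Families are indexed from 1 and blocks from 0, and member 1 is reserved for
    \<open>j\<close>: member \<open>k + 2\<close> carries block \<open>k\<close>.\<close>
  define E where "E i = (if i = 1 then {j} else {p (i - 2)<..p (i - 1)})" for i
  let ?w = "\<lambda>i. x i + (\<Sum>k<r. z k i)"
  have mono: "p k < p l \<longleftrightarrow> k < l" "p k \<le> p l \<longleftrightarrow> k \<le> l" for k l
    using p by (auto simp: strict_mono_less strict_mono_less_eq)
  have E1: "E (Suc 0) = {j}" and ES: "E (Suc (Suc k)) = {p k<..p (Suc k)}" for k
    by (auto simp: E_def)
  have cases: "i = 1 \<or> (\<exists>k<r. i = Suc (Suc k))" if "i \<in> {1..j}" for i
    using that j(3) by (cases i; cases "i - 1") auto
  have a: "admissible j E"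
  proof (rule admissibleI)
    show "1 \<le> j" by fact
    fix i
    show "E i \<noteq> {}" if "i \<in> {1..j}"
      using cases[OF that] mono E1 by (auto simp: ES)
    show "j \<le> q" if "i \<in> {1..j}" "q \<in> E i" for q
    proof -
      have p0: "p 0 \<le> p k" for k using mono by simp
      have "q = j \<or> (\<exists>k. p k < q)" using cases[OF that(1)] that(2) E1 by (auto simp: ES)
      then show ?thesis using j(2) p0 by (meson le_trans less_imp_le order_refl)
    qed
    assume i: "i \<in> {1..<j}"
    then have "i = 1 \<or> (\<exists>k. i = Suc (Suc k))" using cases[of i] by auto
    then show "block_less (E i) (E (Suc i))"
      using j(2) ES[of 0] by (auto simp: E1 ES block_less_def)
  qed
  have w: "?w \<in> c00" using x z by (intro add_in_c00 sum_in_c00) auto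
  have z_eq: "z k i = 0" if "i \<in> {p l<..p (Suc l)}" "k \<noteq> l" for k l i
  proof (rule ccontr)
    assume "z k i \<noteq> 0"
    then have "p k < i" "i \<le> p (Suc k)" using z(2) by auto
    then have "p k < p (Suc l)" "p l < p (Suc k)" using that by auto
    then show False using that(2) mono by simp
  qed
  have "z k j = 0" for k
    using z(2)[of k j] mono(2)[of 0 k] j(2) by (meson le_trans le0 linorder_not_less)
  then have wj: "?w j = x j" by simp
  have wk: "coord_proj (E (Suc (Suc k))) ?w = z k" if "k < r" for k
  proof
    fix i
    show "coord_proj (E (Suc (Suc k))) ?w i = z k i"
    proof (cases "i \<in> {p k<..p (Suc k)}")
      case True
      then have "(\<Sum>k<r. z k i) = (\<Sum>l\<in>{k}. z l i)"
        using that z_eq[OF True] by (intro sum.mono_neutral_right) auto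
      moreover have "x i = 0" using True x(2) mono(2)[of 0 k] by auto
      ultimately show ?thesis using True by (simp add: coord_proj_def ES)
    next
      case False
      then show ?thesis using z(2)[of k i] by (auto simp: coord_proj_def ES)
    qed
  qed
  have "(\<Sum>i=1..j. N (coord_proj (E i) ?w))
      = N (coord_proj (E 1) ?w) + (\<Sum>k<r. N (coord_proj (E (Suc (Suc k))) ?w))"
    unfolding j(3) One_nat_def sum.atLeast1_atMost_eq sum.lessThan_Suc_shift by simp
  moreover have "(\<Sum>k<r. N (coord_proj (E (Suc (Suc k))) ?w)) = (\<Sum>k<r. N (z k))"
    using wk by simp
  moreover have "\<bar>x j\<bar> \<le> N (coord_proj (E 1) ?w)"
    using coord_le_norm[OF coord_proj_c00[OF w], of "E 1" j] wj by (simp add: coord_proj_def E1)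
  ultimately have "\<bar>x j\<bar> + (\<Sum>k<r. N (z k)) \<le> (\<Sum>i=1..j. N (coord_proj (E i) ?w))" by linarith
  then have "(\<bar>x j\<bar> + (\<Sum>k<r. N (z k))) / real n \<le> 1 / real n * (\<Sum>i=1..j. N (coord_proj (E i) ?w))"
    by (simp add: divide_right_mono)
  also have "\<dots> \<le> N ?w" by (rule norm_admissible_ge[OF w a])
  finally show ?thesis .
qed

end

section \<open>Coordinates in the completion\<close>

locale tsirelson_space = tsirelson_reciprocal n for n +
  fixes J :: "(nat \<Rightarrow> real) \<Rightarrow> 'a::banach"
  assumes J: "is_tsirelson_space (1 / real n) J"
begin

lemma J_add: "x \<in> c00 \<Longrightarrow> y \<in> c00 \<Longrightarrow> J (\<lambda>i. x i + y i) = J x + J y"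
  and J_scale: "x \<in> c00 \<Longrightarrow> J (\<lambda>i. a * x i) = a *\<^sub>R J x"
  and norm_J: "x \<in> c00 \<Longrightarrow> norm (J x) = N x"
  and closure_J: "closure (J ` c00) = UNIV"
  using J unfolding is_tsirelson_space_def is_completion_c00_def by blast+

lemma J_zero: "J (\<lambda>_. 0) = 0"
  using norm_J[OF zero_in_c00] norm_zero by simp

lemma diff_in_c00: "x \<in> c00 \<Longrightarrow> y \<in> c00 \<Longrightarrow> (\<lambda>i. x i - y i) \<in> c00"
  using add_in_c00[OF _ scale_in_c00, of x y "-1"] by simp

lemma J_diff: "x \<in> c00 \<Longrightarrow> y \<in> c00 \<Longrightarrow> J (\<lambda>i. x i - y i) = J x - J y"
  using J_add[OF _ scale_in_c00, of x y "-1"] J_scale[of y "-1"] by simp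

lemma J_sum:
  "(\<And>k. k \<in> K \<Longrightarrow> f k \<in> c00) \<Longrightarrow> J (\<lambda>i. \<Sum>k\<in>K. f k i) = (\<Sum>k\<in>K. J (f k))"
  by (induction K rule: infinite_finite_induct) (auto simp: J_zero J_add sum_in_c00)

lemma J_eq_sum_unit_vec:
  assumes "x \<in> c00" "finite S" "{i. x i \<noteq> 0} \<subseteq> S" "0 \<notin> S"
  shows "J x = (\<Sum>i\<in>S. x i *\<^sub>R J (unit_vec i))"
proof -
  have u: "unit_vec i \<in> c00" if "i \<in> S" for i
    using that assms(4) by (intro unit_vec_in_c00) (cases i, auto)
  have "x = (\<lambda>j. \<Sum>i\<in>S. x i * unit_vec i j)"
  proof
    fix j
    have "(\<Sum>i\<in>S. x i * unit_vec i j) = (\<Sum>i\<in>S. if i = j then x i else 0)"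
      by (rule sum.cong) (auto simp: unit_vec_def)
    then show "x j = (\<Sum>i\<in>S. x i * unit_vec i j)" using assms(2,3) by auto
  qed
  then have "J x = J (\<lambda>j. \<Sum>i\<in>S. x i * unit_vec i j)" by simp
  also have "\<dots> = (\<Sum>i\<in>S. x i *\<^sub>R J (unit_vec i))"
    using u by (simp add: J_sum scale_in_c00 J_scale)
  finally show ?thesis .
qed

lemma norm_unit_vec: "1 \<le> i \<Longrightarrow> N (unit_vec i) = 1"
proof (rule antisym)
  assume i: "1 \<le> i"
  show "N (unit_vec i) \<le> 1"
    using step_indicator_le_card[of "{i}"] i unfolding unit_vec_eq_indicator by (intro norm_le) auto
  show "1 \<le> N (unit_vec i)"
    using coord_le_norm[OF unit_vec_in_c00[OF i], of i] by (simp add: unit_vec_def)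
qed

section \<open>Coordinate functionals and truncations on the completion\<close>

lemma ex_approximating_sequence: "\<exists>Z. (\<forall>k. Z k \<in> c00) \<and> (\<lambda>k. J (Z k)) \<longlonglongrightarrow> v"
proof -
  have "v \<in> closure (J ` c00)" using closure_J by simp
  then obtain V where V: "\<forall>k. V k \<in> J ` c00" "V \<longlonglongrightarrow> v" by (auto simp: closure_sequential)
  then have "\<forall>k. \<exists>z\<in>c00. V k = J z" by auto
  then obtain Z where "\<forall>k. Z k \<in> c00 \<and> V k = J (Z k)" by metis
  then have "V = (\<lambda>k. J (Z k))" "\<forall>k. Z k \<in> c00" by auto
  then show ?thesis using V(2) by blast
qed

definition approx :: "'a \<Rightarrow> nat \<Rightarrow> nat \<Rightarrow> real" where
  "approx v = (SOME Z. (\<forall>k. Z k \<in> c00) \<and> (\<lambda>k. J (Z k)) \<longlonglongrightarrow> v)"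

lemma approx: "approx v k \<in> c00" "(\<lambda>k. J (approx v k)) \<longlonglongrightarrow> v"
  using someI_ex[OF ex_approximating_sequence[of v]] unfolding approx_def by blast+

text \<open>The continuous extension of the \<open>j\<close>-th coordinate from \<open>c00\<close>;
  \<open>coord_tendsto\<close> shows that the limit exists and does not depend on the chosen
  sequence.\<close>

definition coord :: "'a \<Rightarrow> nat \<Rightarrow> real" where
  "coord v j = lim (\<lambda>k. approx v k j)"

lemma coord_diff_le: "x \<in> c00 \<Longrightarrow> y \<in> c00 \<Longrightarrow> \<bar>x j - y j\<bar> \<le> norm (J x - J y)"
  using coord_le_norm[OF diff_in_c00, of x y j] norm_J[OF diff_in_c00, of x y] J_diff[of x y] by simp

text \<open>Coordinates on \<open>c00\<close> are 1-Lipschitz for the norm, so Cauchy sequences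
  converge coordinatewise, and two sequences with the same limit have the same coordinate
  limits.\<close>

lemma coord_tendsto:
  assumes Z: "\<And>k. Z k \<in> c00" "(\<lambda>k. J (Z k)) \<longlonglongrightarrow> v"
  shows "(\<lambda>k. Z k j) \<longlonglongrightarrow> coord v j"
proof -
  have "Cauchy (\<lambda>k. J (approx v k))" using approx(2) by (rule LIMSEQ_imp_Cauchy)
  then have "Cauchy (\<lambda>k. approx v k j)"
    unfolding Cauchy_def dist_norm real_norm_def
    using coord_diff_le[OF approx(1) approx(1)] by (meson le_less_trans)
  then have *: "(\<lambda>k. approx v k j) \<longlonglongrightarrow> coord v j"
    unfolding coord_def by (simp add: Cauchy_convergent_iff convergent_LIMSEQ_iff)
  have "(\<lambda>k. norm (J (Z k) - J (approx v k))) \<longlonglongrightarrow> 0"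
    using tendsto_norm[OF tendsto_diff[OF Z(2) approx(2)[of v]]] by simp
  then have "(\<lambda>k. Z k j - approx v k j) \<longlonglongrightarrow> 0"
    by (rule Lim_null_comparison[rotated]) (use coord_diff_le[OF Z(1) approx(1)] in auto)
  then show ?thesis using tendsto_add[OF _ *] by fastforce
qed

lemma coord_J: "z \<in> c00 \<Longrightarrow> coord (J z) j = z j"
  using coord_tendsto[of "\<lambda>_. z" "J z" j] by (simp add: LIMSEQ_const_iff)

lemma coord_add: "coord (v + w) j = coord v j + coord w j"
proof (rule LIMSEQ_unique)
  show "(\<lambda>k. approx v k j + approx w k j) \<longlonglongrightarrow> coord (v + w) j"
    using tendsto_add[OF approx(2) approx(2), of v w]
    by (intro coord_tendsto[of "\<lambda>k i. approx v k i + approx w k i"]) (auto simp: approx add_in_c00 J_add)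
  show "(\<lambda>k. approx v k j + approx w k j) \<longlonglongrightarrow> coord v j + coord w j"
    by (intro tendsto_add coord_tendsto approx)
qed

lemma coord_scale: "coord (a *\<^sub>R v) j = a * coord v j"
proof (rule LIMSEQ_unique)
  show "(\<lambda>k. a * approx v k j) \<longlonglongrightarrow> coord (a *\<^sub>R v) j"
    using tendsto_scaleR[OF tendsto_const approx(2), of a v]
    by (intro coord_tendsto[of "\<lambda>k i. a * approx v k i"]) (auto simp: approx scale_in_c00 J_scale)
  show "(\<lambda>k. a * approx v k j) \<longlonglongrightarrow> a * coord v j"
    by (intro tendsto_mult tendsto_const coord_tendsto approx)
qed

lemma coord_le: "\<bar>coord v j\<bar> \<le> norm v"
proof (rule LIMSEQ_le)
  show "(\<lambda>k. \<bar>approx v k j\<bar>) \<longlonglongrightarrow> \<bar>coord v j\<bar>"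
    by (intro tendsto_rabs coord_tendsto approx)
  show "(\<lambda>k. norm (J (approx v k))) \<longlonglongrightarrow> norm v"
    by (intro tendsto_norm approx)
  show "\<exists>K. \<forall>k\<ge>K. \<bar>approx v k j\<bar> \<le> norm (J (approx v k))"
    using coord_le_norm[OF approx(1)] norm_J[OF approx(1)] by auto
qed

lemma bounded_linear_coord: "bounded_linear (\<lambda>v. coord v j)"
  by (rule bounded_linear_intro[where K = 1]) (auto simp: coord_add coord_scale coord_le)

lemma coord_zero_index: "coord v 0 = 0"
proof -
  have "approx v k 0 = 0" for k using approx(1)[of v k] by (simp add: c00_def)
  then show ?thesis by (simp add: coord_def)
qed

definition trunc :: "nat \<Rightarrow> 'a \<Rightarrow> nat \<Rightarrow> real" where
  "trunc p v = coord_proj {..p} (coord v)"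

lemma trunc_in_c00: "trunc p v \<in> c00"
  by (rule in_c00_if_bounded_support[of _ p]) (auto simp: trunc_def coord_proj_def coord_zero_index)

lemma norm_le_sum:
  assumes "x \<in> c00" "\<And>i. i > p \<Longrightarrow> x i = 0"
  shows "N x \<le> (\<Sum>i\<le>p. \<bar>x i\<bar>)"
proof -
  have "{j. x j \<noteq> 0} \<subseteq> {..p}" using assms(2) by (force simp: not_less[symmetric])
  then show ?thesis using norm_le_l1[OF assms(1)] l1_norm_eq_sum[of "{..p}" x] by simp
qed

text \<open>Only the finitely many coordinates up to \<open>p\<close> enter, and there the l1 norm
  of the difference, which dominates the norm, tends to 0.\<close>

lemma trunc_tendsto:
  assumes Z: "\<And>k. Z k \<in> c00" "(\<lambda>k. J (Z k)) \<longlonglongrightarrow> v"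
  shows "(\<lambda>k. J (coord_proj {..p} (Z k))) \<longlonglongrightarrow> J (trunc p v)"
proof -
  let ?d = "\<lambda>k i. coord_proj {..p} (Z k) i - trunc p v i"
  have d: "?d k \<in> c00" for k by (intro diff_in_c00 coord_proj_c00 trunc_in_c00 Z)
  have "(\<lambda>k. \<Sum>i\<le>p. \<bar>Z k i - coord v i\<bar>) \<longlonglongrightarrow> (\<Sum>i\<le>p. \<bar>coord v i - coord v i\<bar>)"
    by (intro tendsto_intros coord_tendsto Z)
  then have lim: "(\<lambda>k. \<Sum>i\<le>p. \<bar>Z k i - coord v i\<bar>) \<longlonglongrightarrow> 0" by simp
  have "norm (J (coord_proj {..p} (Z k)) - J (trunc p v)) \<le> (\<Sum>i\<le>p. \<bar>Z k i - coord v i\<bar>)" for k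
  proof -
    have "norm (J (coord_proj {..p} (Z k)) - J (trunc p v)) = N (?d k)"
      using J_diff[OF coord_proj_c00[OF Z(1)] trunc_in_c00] norm_J[OF d] by simp
    also have "\<dots> \<le> (\<Sum>i\<le>p. \<bar>?d k i\<bar>)"
      by (intro norm_le_sum d) (auto simp: trunc_def coord_proj_def)
    also have "\<dots> = (\<Sum>i\<le>p. \<bar>Z k i - coord v i\<bar>)"
      by (intro sum.cong) (auto simp: trunc_def coord_proj_def)
    finally show ?thesis .
  qed
  then have "(\<lambda>k. J (coord_proj {..p} (Z k)) - J (trunc p v)) \<longlonglongrightarrow> 0"
    by (intro Lim_null_comparison[OF _ lim]) auto
  then show ?thesis by (simp add: LIM_zero_iff)
qed

lemma norm_trunc_le: "norm (J (trunc p v)) \<le> norm v"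
proof (rule LIMSEQ_le)
  show "(\<lambda>k. norm (J (coord_proj {..p} (approx v k)))) \<longlonglongrightarrow> norm (J (trunc p v))"
    by (intro tendsto_norm trunc_tendsto approx)
  show "(\<lambda>k. norm (J (approx v k))) \<longlonglongrightarrow> norm v"
    by (intro tendsto_norm approx)
  show "\<exists>K. \<forall>k\<ge>K. norm (J (coord_proj {..p} (approx v k))) \<le> norm (J (approx v k))"
    using norm_coord_proj_le[OF approx(1)] by (simp add: norm_J approx coord_proj_c00)
qed

text \<open>Convergence of the basis expansion. Truncation is a contraction and fixes a finitely
  supported \<open>z\<close> near \<open>v\<close> once \<open>p\<close> passes its support, so the
  distance is at most twice that from \<open>v\<close> to \<open>z\<close>.\<close>

lemma trunc_approx:
  assumes "e > 0"
  shows "\<exists>q. \<forall>p\<ge>q. norm (v - J (trunc p v)) \<le> e"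
proof -
  have "\<forall>\<^sub>F k in sequentially. dist (J (approx v k)) v < e / 2"
    using assms by (intro tendstoD approx) auto
  then obtain k where "dist (J (approx v k)) v < e / 2" by (auto simp: eventually_sequentially)
  then obtain z where z: "z \<in> c00" "norm (J z - v) < e / 2" using approx(1) by (auto simp: dist_norm)
  obtain q where q: "\<And>i. i > q \<Longrightarrow> z i = 0" using c00_bounded_support[OF z(1)] by blast
  have "norm (v - J (trunc p v)) \<le> e" if "p \<ge> q" for p
  proof -
    have *: "coord (v - J z) i = coord v i - z i" for i
      using coord_add[of v "(-1) *\<^sub>R J z" i] coord_scale[of "-1" "J z" i] coord_J[OF z(1)] by simp
    have "trunc p (v - J z) = (\<lambda>i. trunc p v i - z i)"
      using q that by (auto simp: trunc_def coord_proj_def *)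
    then have "J (trunc p (v - J z)) = J (trunc p v) - J z" using J_diff[OF trunc_in_c00 z(1)] by simp
    then have "norm (J (trunc p v) - J z) < e / 2"
      using norm_trunc_le[of p "v - J z"] z(2) by (simp add: norm_minus_commute)
    then show ?thesis using z(2) norm_triangle_ineq[of "v - J z" "J z - J (trunc p v)"]
      by (simp add: norm_minus_commute)
  qed
  then show ?thesis by blast
qed

lemma eq_J_if_coord_eq:
  assumes "z \<in> c00" "\<And>j. coord v j = z j"
  shows "v = J z"
proof -
  obtain q where q: "\<And>i. i > q \<Longrightarrow> z i = 0" using c00_bounded_support[OF assms(1)] by blast
  have "norm (v - J z) \<le> e" if "e > 0" for e
  proof -
    obtain p where "\<forall>p'\<ge>p. norm (v - J (trunc p' v)) \<le> e" using trunc_approx[OF \<open>e > 0\<close>] by blast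
    then have "norm (v - J (trunc (max p q) v)) \<le> e" by simp
    moreover have "trunc (max p q) v = z" using q by (auto simp: trunc_def coord_proj_def assms(2))
    ultimately show ?thesis by simp
  qed
  then have "norm (v - J z) \<le> 0" by (rule field_le_epsilon) simp
  then show ?thesis by simp
qed

lemma eq_J_trunc: "(\<And>i. i > p \<Longrightarrow> coord v i = 0) \<Longrightarrow> v = J (trunc p v)"
  by (intro eq_J_if_coord_eq trunc_in_c00) (auto simp: trunc_def coord_proj_def)

section \<open>Bounded functionals and signed permutations along the basis\<close>

text \<open>On an infinite set of such indices, \<open>small_step_vector\<close> would give convex
  combinations of unit vectors of arbitrarily small norm, while \<open>f\<close> stays at least
  \<open>\<delta>\<close> on all of them.\<close>

lemma finite_functional_ge:
  fixes f :: "'a \<Rightarrow> real"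
  assumes f: "bounded_linear f" and "\<delta> > 0"
  shows "finite {m. 1 \<le> m \<and> \<delta> \<le> f (J (unit_vec m))}" (is "finite ?M")
proof (rule ccontr)
  assume inf: "infinite ?M"
  interpret f: bounded_linear f by fact
  obtain K where K: "K > 0" "\<And>v. norm (f v) \<le> norm v * K" using f.pos_bounded by blast
  \<comment> \<open>The average will have norm at most \<open>2 * \<eta>\<close>, one
    \<open>\<eta>\<close> from its level norm and one from the higher levels, so that
    \<open>f\<close> is at most \<open>\<delta> / 2\<close> on it.\<close>
  define \<eta> where "\<eta> = \<delta> / (4 * K)"
  have "\<eta> > 0" using K \<open>\<delta> > 0\<close> by (simp add: \<eta>_def)
  have "1 / real n < 1" using n_ge_2 by simp
  then obtain k where k: "(1 / real n) ^ k < \<eta>"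
    using real_arch_pow_inv[OF \<open>\<eta> > 0\<close>] by blast
  have "(1 / real n) ^ Suc k \<le> (1 / real n) ^ k" using n_ge_2 by (intro power_decreasing) auto
  obtain x where x: "x \<in> c00" "\<And>i. x i \<ge> 0" "{i. x i \<noteq> 0} \<subseteq> ?M" "l1_norm x = 1"
    "stepnorm k x \<le> \<eta>" using small_step_vector[OF inf \<open>\<eta> > 0\<close>, of k] by blast
  have fin: "finite {i. x i \<noteq> 0}" using x by (simp add: c00_def)
  have "N x \<le> 2 * \<eta>"
    using norm_le_l1_step[OF x(1), of k] x(4,5) k \<open>_ ^ Suc k \<le> _\<close> by simp
  then have "norm (J x) * K \<le> (2 * \<eta>) * K" using K by (simp add: norm_J[OF x(1)])
  also have "\<dots> = \<delta> / 2" using K by (simp add: \<eta>_def)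
  finally have "f (J x) \<le> \<delta> / 2" using K(2)[of "J x"] by simp
  moreover have "f (J x) = (\<Sum>i | x i \<noteq> 0. x i * f (J (unit_vec i)))"
    using J_eq_sum_unit_vec[OF x(1) fin] x(1) by (simp add: f.sum f.scaleR c00_def)
  moreover have "(\<Sum>i | x i \<noteq> 0. x i * f (J (unit_vec i))) \<ge> (\<Sum>i | x i \<noteq> 0. \<bar>x i\<bar> * \<delta>)"
    using x(2,3) by (intro sum_mono) (auto intro!: mult_left_mono)
  moreover have "(\<Sum>i | x i \<noteq> 0. \<bar>x i\<bar> * \<delta>) = \<delta>"
    using x(4) by (simp flip: sum_distrib_right)
  ultimately show False using \<open>\<delta> > 0\<close> by simp
qed

lemma functional_unit_vec_tendsto_0:
  fixes f :: "'a \<Rightarrow> real"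
  assumes f: "bounded_linear f"
  shows "(\<lambda>m. f (J (unit_vec m))) \<longlonglongrightarrow> 0"
proof (rule LIMSEQ_I)
  fix \<delta> :: real assume "\<delta> > 0"
  have "finite ({m. 1 \<le> m \<and> \<delta> \<le> f (J (unit_vec m))} \<union> {m. 1 \<le> m \<and> \<delta> \<le> - f (J (unit_vec m))})"
    using finite_functional_ge[OF f \<open>\<delta> > 0\<close>]
      finite_functional_ge[OF bounded_linear_minus[OF f] \<open>\<delta> > 0\<close>] by blast
  then obtain q where q: "\<forall>m\<in>{m. 1 \<le> m \<and> \<delta> \<le> f (J (unit_vec m))} \<union> {m. 1 \<le> m \<and> \<delta> \<le> - f (J (unit_vec m))}. m \<le> q"
    by (meson finite_nat_set_iff_bounded_le)
  have "norm (f (J (unit_vec m)) - 0) < \<delta>" if "m \<ge> Suc q" for m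
  proof -
    have "\<not> m \<le> q" "1 \<le> m" using that by auto
    then have "\<not> \<delta> \<le> f (J (unit_vec m))" "\<not> \<delta> \<le> - f (J (unit_vec m))" using q by blast+
    then show ?thesis by simp
  qed
  then show "\<exists>no. \<forall>m\<ge>no. norm (f (J (unit_vec m)) - 0) < \<delta>" by blast
qed

text \<open>Expand \<open>g\<close> in unit vectors and reindex by \<open>\<pi>\<close>. The action
  of \<open>U\<close> is assumed on the support of \<open>g\<close> only, so that the lemma can
  serve inside an induction on the index.\<close>

lemma signed_permutation_image:
  assumes U: "linear U" and \<pi>: "\<pi> permutes {1..n}" and g: "g \<in> c00"
    and e: "\<And>j. g j \<noteq> 0 \<Longrightarrow> U (J (unit_vec j)) = \<epsilon> j *\<^sub>R J (unit_vec (\<pi> j))"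
  defines "g' \<equiv> \<lambda>l. \<epsilon> (inv \<pi> l) * g (inv \<pi> l)"
  shows "g' \<in> c00" "U (J g) = J g'"
proof -
  let ?S = "{i. g i \<noteq> 0}"
  have S: "finite ?S" "0 \<notin> ?S" using g by (auto simp: c00_def)
  have \<pi>0: "\<pi> 0 = 0" "inv \<pi> 0 = 0"
    using permutes_not_in[OF \<pi>] permutes_not_in[OF permutes_inv[OF \<pi>]] by auto
  have supp: "{l. g' l \<noteq> 0} \<subseteq> \<pi> ` ?S"
  proof
    fix l assume "l \<in> {l. g' l \<noteq> 0}"
    then have "g (inv \<pi> l) \<noteq> 0" by (auto simp: g'_def)
    then show "l \<in> \<pi> ` ?S" using permutes_inverses(1)[OF \<pi>, of l]
      by (metis (mono_tags, lifting) imageI mem_Collect_eq)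
  qed
  show g': "g' \<in> c00"
    using finite_subset[OF supp] S \<pi>0 by (auto simp: c00_def g'_def)
  have "0 \<notin> \<pi> ` ?S" using S(2) \<pi>0 permutes_inj[OF \<pi>] by (metis (no_types, lifting) image_iff injD)
  then have "J g' = (\<Sum>l\<in>\<pi> ` ?S. g' l *\<^sub>R J (unit_vec l))"
    using S by (intro J_eq_sum_unit_vec g' supp) auto
  also have "\<dots> = (\<Sum>i\<in>?S. g' (\<pi> i) *\<^sub>R J (unit_vec (\<pi> i)))"
    using permutes_inj[OF \<pi>] by (subst sum.reindex) (auto intro: inj_on_subset)
  also have "\<dots> = (\<Sum>i\<in>?S. g i *\<^sub>R U (J (unit_vec i)))"
    using e by (intro sum.cong) (auto simp: g'_def permutes_inverses(2)[OF \<pi>])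
  also have "\<dots> = U (\<Sum>i\<in>?S. g i *\<^sub>R J (unit_vec i))"
    using U by (simp add: linear_sum linear_scale)
  also have "\<dots> = U (J g)" using J_eq_sum_unit_vec[OF g S(1) order_refl S(2)] by simp
  finally show "U (J g) = J g'" by simp
qed

end

section \<open>Linear isometries\<close>

locale tsirelson_isometry = tsirelson_space n J for n and J :: "(nat \<Rightarrow> real) \<Rightarrow> 'a::banach" +
  fixes U :: "'a \<Rightarrow> 'a"
  assumes U: "bounded_linear U" and norm_U: "\<And>v. norm (U v) = norm v"
begin

section \<open>Images of far unit vectors as almost disjoint blocks\<close>

abbreviation img :: "nat \<Rightarrow> 'a" where
  "img i \<equiv> U (J (unit_vec i))"

lemma linear_U: "linear U"
  using U by (rule bounded_linear.linear)

lemma coord_img_tendsto_0: "(\<lambda>m. coord (img m) j) \<longlonglongrightarrow> 0"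
  by (rule functional_unit_vec_tendsto_0[OF bounded_linear_compose[OF bounded_linear_coord U]])

text \<open>For fixed \<open>p\<close> the first coordinates of \<open>img m\<close> tend to 0, so a
  large \<open>m\<close> makes their sum small; cutting off a tail at \<open>q\<close> costs the
  other \<open>\<eta> / 2\<close>.\<close>

lemma approx_img_by_block:
  assumes "\<eta> > 0"
  shows "\<exists>m z q. m > L \<and> z \<in> c00 \<and> q > p \<and> (\<forall>i. z i \<noteq> 0 \<longrightarrow> p < i \<and> i \<le> q)
    \<and> norm (img m - J z) \<le> \<eta>"
proof -
  have "(\<lambda>m. \<Sum>i\<le>p. \<bar>coord (img m) i\<bar>) \<longlonglongrightarrow> (\<Sum>i\<le>p. \<bar>0\<bar>)"
    by (intro tendsto_sum tendsto_rabs coord_img_tendsto_0)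
  then have "\<forall>\<^sub>F m in sequentially. (\<Sum>i\<le>p. \<bar>coord (img m) i\<bar>) < \<eta> / 2"
    using assms by (intro order_tendstoD(2)[where y = 0]) auto
  then obtain m0 where "\<forall>m\<ge>m0. (\<Sum>i\<le>p. \<bar>coord (img m) i\<bar>) < \<eta> / 2"
    by (auto simp: eventually_sequentially)
  then obtain m where m: "m > L" "(\<Sum>i\<le>p. \<bar>coord (img m) i\<bar>) < \<eta> / 2"
    by (metis le_add1 le_add2 less_Suc_eq_le add_Suc_right)
  have "\<eta> / 2 > 0" using assms by simp
  then obtain q0 where "\<forall>q\<ge>q0. norm (img m - J (trunc q (img m))) \<le> \<eta> / 2"
    using trunc_approx by blast
  then obtain q where q: "q > p" "norm (img m - J (trunc q (img m))) \<le> \<eta> / 2"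
    by (metis le_add1 le_add2 less_Suc_eq_le add_Suc_right)
  let ?z = "coord_proj {p<..} (trunc q (img m))"
  have z: "?z \<in> c00" by (intro coord_proj_c00 trunc_in_c00)
  have "trunc q (img m) = (\<lambda>i. trunc p (img m) i + ?z i)"
    using q(1) by (auto simp: trunc_def coord_proj_def)
  then have "J (trunc q (img m)) = J (trunc p (img m)) + J ?z"
    using J_add[OF trunc_in_c00 z, of p "img m"] by simp
  then have "img m - J ?z = (img m - J (trunc q (img m))) + J (trunc p (img m))" by simp
  then have "norm (img m - J ?z) \<le> norm (img m - J (trunc q (img m))) + norm (J (trunc p (img m)))"
    using norm_triangle_ineq by metis
  moreover have "norm (J (trunc p (img m))) \<le> (\<Sum>i\<le>p. \<bar>coord (img m) i\<bar>)"
    using norm_le_sum[OF trunc_in_c00, of p p "img m"] by (simp add: norm_J trunc_in_c00) (simp add: trunc_def coord_proj_def)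
  ultimately have "norm (img m - J ?z) \<le> \<eta>" using m q by linarith
  then show ?thesis using m q z
    by (intro exI[of _ m] exI[of _ ?z] exI[of _ q]) (auto simp: trunc_def coord_proj_def split: if_splits)
qed

lemma gliding_hump:
  assumes "\<eta> > 0"
  obtains m :: "nat \<Rightarrow> nat" and z :: "nat \<Rightarrow> nat \<Rightarrow> real" and p :: "nat \<Rightarrow> nat"
  where "\<And>k. m k > L" "strict_mono m" "p 0 = p0" "strict_mono p" "\<And>k. z k \<in> c00"
    "\<And>k i. z k i \<noteq> 0 \<Longrightarrow> p k < i \<and> i \<le> p (Suc k)" "\<And>k. norm (img (m k) - J (z k)) \<le> \<eta>"
proof -
  \<comment> \<open>A state holds an index, its block and the ends of the range of the block. The
    next range starts where the last one ends; the clause for \<open>k = 0\<close> fixes the start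
    of the first.\<close>
  let ?P = "\<lambda>(k::nat) (m, z, p, q). m > L \<and> z \<in> c00 \<and> p < q
    \<and> (\<forall>i. z i \<noteq> 0 \<longrightarrow> p < i \<and> i \<le> q) \<and> norm (img m - J z) \<le> \<eta> \<and> (k = 0 \<longrightarrow> p = p0)"
  let ?Q = "\<lambda>(k::nat) (m, z, p, q) (m', z', p', q'). m < m' \<and> p' = q"
  have "\<exists>f. \<forall>k. ?P k (f k) \<and> ?Q k (f k) (f (Suc k))"
  proof (rule dependent_nat_choice)
    show "\<exists>x. ?P 0 x"
      using approx_img_by_block[OF assms, of L p0] by auto
    fix x :: "nat \<times> (nat \<Rightarrow> real) \<times> nat \<times> nat" and k
    assume P: "?P k x"
    obtain m z p q where x: "x = (m, z, p, q)" by (cases x)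
    obtain m' z' q' where "m' > m" "z' \<in> c00" "q' > q" "\<forall>i. z' i \<noteq> 0 \<longrightarrow> q < i \<and> i \<le> q'"
      "norm (img m' - J z') \<le> \<eta>"
      using approx_img_by_block[OF assms, of m q] by blast
    then show "\<exists>y. ?P (Suc k) y \<and> ?Q k x y"
      using P unfolding x by (intro exI[of _ "(m', z', q, q')"]) auto
  qed
  then obtain f where f: "\<forall>k. ?P k (f k) \<and> ?Q k (f k) (f (Suc k))" ..
  define m where "m k = fst (f k)" for k
  define z where "z k = fst (snd (f k))" for k
  define p where "p k = fst (snd (snd (f k)))" for k
  define q where "q k = snd (snd (snd (f k)))" for k
  have f_eq: "f k = (m k, z k, p k, q k)" for k by (simp add: m_def z_def p_def q_def)
  have P: "m k > L \<and> z k \<in> c00 \<and> p k < q k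
    \<and> (\<forall>i. z k i \<noteq> 0 \<longrightarrow> p k < i \<and> i \<le> q k) \<and> norm (img (m k) - J (z k)) \<le> \<eta> \<and> (k = 0 \<longrightarrow> p k = p0)" for k
    using f[rule_format, of k] unfolding f_eq by simp
  have Q: "m k < m (Suc k) \<and> p (Suc k) = q k" for k
    using f[rule_format, of k] unfolding f_eq by simp
  show ?thesis
    using P Q by (intro that[of m p z]) (auto simp: strict_mono_Suc_iff)
qed

text \<open>
  With \<open>r = j - 1\<close>, the norm of \<open>e\<^sub>i\<close> plus any \<open>r\<close> later unit vectors is at most \<open>r / n\<close>.
  If these are sparse enough, then their images are almost disjoint blocks far out, and a nonzero
  \<open>j\<close>-th coordinate of \<open>U e\<^sub>i\<close> would push the norm of the image above \<open>r / n\<close>.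
\<close>

lemma coord_img_eq_0:
  assumes i: "1 \<le> i" "i < j" and j: "n < j"
  shows "coord (img i) j = 0"
proof (rule ccontr)
  assume nz: "coord (img i) j \<noteq> 0"
  define r where "r = j - 1"
  have r: "j = Suc r" "i \<le> r" "n \<le> r" using i j by (auto simp: r_def)
  define \<delta> where "\<delta> = \<bar>coord (img i) j\<bar>"
  \<comment> \<open>The errors are \<open>r * \<eta>\<close>, from blocks of norm at least
    \<open>1 - \<eta>\<close>, and \<open>n * (r + 1) * \<eta>\<close>, from approximating
    \<open>r + 1\<close> images. This choice makes their sum \<open>\<delta> / 2\<close>.\<close>
  define \<eta> where "\<eta> = \<delta> / (2 * (real r + real n * real (Suc r)))"
  have pos: "real r + real n * real (Suc r) > 0" using r n_ge_2 by (intro add_nonneg_pos) auto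
  have "\<delta> > 0" using nz by (simp add: \<delta>_def)
  then have "\<eta> > 0" using pos by (simp add: \<eta>_def)
  obtain p1 where "\<forall>p\<ge>p1. norm (img i - J (trunc p (img i))) \<le> \<eta>"
    using trunc_approx[OF \<open>\<eta> > 0\<close>] by blast
  then obtain p0 where p0: "p0 \<ge> j" "norm (img i - J (trunc p0 (img i))) \<le> \<eta>"
    by (metis nle_le)
  obtain m z p where mzp: "\<And>k. m k > i" "strict_mono m" "p 0 = p0" "strict_mono p"
    "\<And>k. z k \<in> c00" "\<And>k l. z k l \<noteq> 0 \<Longrightarrow> p k < l \<and> l \<le> p (Suc k)"
    "\<And>k. norm (img (m k) - J (z k)) \<le> \<eta>"
    using gliding_hump[OF \<open>\<eta> > 0\<close>, of i p0] by blast
  let ?x = "trunc p0 (img i)"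
  let ?w = "\<lambda>l. ?x l + (\<Sum>k<r. z k l)"
  let ?S = "m ` {..<r}"
  have inj: "inj_on m {..<r}" using mzp(2) strict_mono_imp_inj_on inj_on_subset by blast
  have S: "finite ?S" "card ?S = r" "\<And>s. s \<in> ?S \<Longrightarrow> i < s" "i \<notin> ?S" "0 \<notin> insert i ?S"
  proof -
    show "\<And>s. s \<in> ?S \<Longrightarrow> i < s" using mzp(1) by auto
    then show "i \<notin> ?S" "0 \<notin> insert i ?S" using i(1) by (blast, force)
  qed (use inj in \<open>auto simp: card_image\<close>)
  have "1 - \<eta> \<le> N (z k)" for k
  proof -
    have "1 \<le> m k" using mzp(1)[of k] by simp
    then have "norm (img (m k)) = 1" by (simp add: norm_U norm_J norm_unit_vec unit_vec_in_c00)
    then show ?thesis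
      using mzp(7)[of k] norm_triangle_ineq2[of "img (m k)" "J (z k)"] norm_J[OF mzp(5)[of k]] by simp
  qed
  then have "(\<Sum>k<r. 1 - \<eta>) \<le> (\<Sum>k<r. N (z k))" by (rule sum_mono)
  then have "(\<delta> + real r * (1 - \<eta>)) / real n \<le> (\<bar>?x j\<bar> + (\<Sum>k<r. N (z k))) / real n"
    using p0(1) by (intro divide_right_mono) (auto simp: \<delta>_def trunc_def coord_proj_def)
  also have "\<dots> \<le> N ?w"
    using p0(1) i r mzp by (intro norm_blocks_ge[where p = p]) (auto simp: trunc_in_c00, auto simp: trunc_def coord_proj_def)
  also have "\<dots> = norm (J ?x + (\<Sum>k<r. J (z k)))"
    using mzp(5) by (simp flip: norm_J J_sum J_add add: add_in_c00 sum_in_c00 trunc_in_c00)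
  also have "\<dots> \<le> norm (img i + (\<Sum>k<r. img (m k))) + real (Suc r) * \<eta>"
  proof -
    let ?B = "img i + (\<Sum>k<r. img (m k))"
    let ?D = "(img i - J ?x) + (\<Sum>k<r. img (m k) - J (z k))"
    have eq: "J ?x + (\<Sum>k<r. J (z k)) = ?B - ?D"
      by (simp add: sum_subtractf)
    have "norm ?D \<le> \<eta> + (\<Sum>k<r. \<eta>)"
      using p0(2) mzp(7) by (intro norm_triangle_le add_mono sum_norm_le)
    then have "norm ?D \<le> real (Suc r) * \<eta>" by (simp add: distrib_right)
    then show ?thesis unfolding eq using norm_triangle_ineq4[of ?B ?D] by linarith
  qed
  also have "img i + (\<Sum>k<r. img (m k)) = U (\<Sum>s\<in>insert i ?S. J (unit_vec s))"
    using S inj linear_U by (simp add: sum.reindex linear_add linear_sum)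
  also have "(\<Sum>s\<in>insert i ?S. J (unit_vec s)) = J (indicator (insert i ?S))"
  proof -
    have "J (indicator (insert i ?S)) = (\<Sum>s\<in>insert i ?S. indicator (insert i ?S) s *\<^sub>R J (unit_vec s))"
      using S by (intro J_eq_sum_unit_vec indicator_in_c00) (auto simp: indicator_def)
    then show ?thesis by (simp add: indicator_def del: sum.insert)
  qed
  also have "norm (U (J (indicator (insert i ?S)))) = N (indicator (insert i ?S))"
    using S by (simp add: norm_U norm_J indicator_in_c00)
  also have "\<dots> \<le> real r / real n"
    using norm_indicator_insert_le[of ?S i] S i r by simp
  finally have "(\<delta> + real r * (1 - \<eta>)) / real n \<le> real r / real n + real (Suc r) * \<eta>" by simp
  then have "\<delta> + real r * (1 - \<eta>) \<le> real r + real n * (real (Suc r) * \<eta>)"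
    using n_ge_2 by (subst (asm) pos_divide_le_eq) (auto simp: distrib_right mult.commute[of _ "real n"] distrib_left[of "real n"])
  then have "\<delta> \<le> \<eta> * (real r + real n * real (Suc r))" by (simp add: algebra_simps)
  also have "\<dots> = \<delta> / 2"
  proof -
    have "a / (2 * d) * d = a / 2" if "d > 0" for a d :: real using that by simp
    then show ?thesis unfolding \<eta>_def using pos by blast
  qed
  finally show False using \<open>\<delta> > 0\<close> by simp
qed

section \<open>The action of an isometry on the first \<open>n\<close> unit vectors\<close>

lemma coord_U_sum:
  "coord (U (\<Sum>i\<in>S. a i *\<^sub>R J (unit_vec i))) j = (\<Sum>i\<in>S. a i * coord (img i) j)"
proof -
  interpret bounded_linear "\<lambda>v. coord (U v) j"
    by (rule bounded_linear_compose[OF bounded_linear_coord U])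
  show ?thesis by (simp add: sum scaleR)
qed

text \<open>Apply \<open>U\<close> to the combination of the first \<open>n\<close> unit vectors
  with the signs of the row as coefficients. Its norm is at most 1 by \<open>norm_le_sup\<close>,
  and coordinate \<open>a\<close> of its image is the row sum.\<close>

lemma row_sum_le:
  "(\<Sum>i=1..n. \<bar>coord (img i) a\<bar>) \<le> 1"
proof -
  let ?w = "\<lambda>i. if i \<in> {1..n} then sgn (coord (img i) a) else 0"
  have w: "?w \<in> c00" by (rule in_c00_if_bounded_support[of _ n]) auto
  have "J ?w = (\<Sum>i=1..n. ?w i *\<^sub>R J (unit_vec i))"
    using w by (intro J_eq_sum_unit_vec) auto
  then have "coord (U (J ?w)) a = (\<Sum>i=1..n. ?w i * coord (img i) a)"
    by (simp only: coord_U_sum)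
  also have "\<dots> = (\<Sum>i=1..n. \<bar>coord (img i) a\<bar>)"
    by (intro sum.cong) (auto simp: abs_sgn mult.commute)
  finally have "(\<Sum>i=1..n. \<bar>coord (img i) a\<bar>) \<le> norm (U (J ?w))"
    using coord_le[of "U (J ?w)" a] by linarith
  also have "\<dots> = N ?w" by (simp only: norm_U norm_J w)
  also have "\<dots> \<le> 1" using w by (intro norm_le_sup) (auto simp: sgn_if)
  finally show ?thesis .
qed

text \<open>By \<open>coord_img_eq_0\<close> the image lives on the first \<open>n\<close>
  coordinates, where the norm is the supremum norm; a vector of norm 1 attains it there.\<close>

lemma ex_unimodular_coord:
  assumes i: "i \<in> {1..n}"
  shows "\<exists>a\<in>{1..n}. \<bar>coord (img i) a\<bar> = 1"
proof -
  let ?B = "Max ((\<lambda>a. \<bar>coord (img i) a\<bar>) ` {1..n})"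
  have nonempty: "{1..n} \<noteq> {}" using n_ge_2 by simp
  have le: "\<bar>coord (img i) a\<bar> \<le> ?B" if "a \<in> {1..n}" for a using that by (intro Max_ge) auto
  have B0: "0 \<le> ?B" using le[OF i] by linarith
  have "img i = J (trunc n (img i))"
    using i by (intro eq_J_trunc coord_img_eq_0) auto
  then have "norm (img i) = N (trunc n (img i))" using norm_J[OF trunc_in_c00] by metis
  also have "\<dots> \<le> ?B"
  proof (rule norm_le_sup)
    show "\<bar>trunc n (img i) a\<bar> \<le> ?B" for a
      using le[of a] B0 by (cases "a = 0") (auto simp: trunc_def coord_proj_def coord_zero_index)
  qed (auto simp: trunc_in_c00, auto simp: trunc_def coord_proj_def)
  finally have "1 \<le> ?B"
    using i by (simp add: norm_U norm_J unit_vec_in_c00 norm_unit_vec)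
  moreover obtain a where a: "a \<in> {1..n}" "?B = \<bar>coord (img i) a\<bar>"
    using Max_in[of "(\<lambda>a. \<bar>coord (img i) a\<bar>) ` {1..n}"] nonempty
    by (metis (no_types, lifting) finite_atLeastAtMost finite_imageI image_iff image_is_empty)
  moreover have "\<bar>coord (img i) a\<bar> \<le> 1"
    using coord_le[of "img i" a] i by (simp add: norm_U norm_J unit_vec_in_c00 norm_unit_vec)
  ultimately show ?thesis by (intro bexI[of _ a]) auto
qed

text \<open>Every column of the matrix has an entry of modulus 1, and the row sums leave no room for
  a second nonzero entry in its row. So these entries lie in distinct rows, exhaust the rows, and
  all other entries vanish.\<close>

lemma signed_permutation_initial:
  obtains \<pi> \<epsilon> where "\<pi> permutes {1..n}"
    "\<And>i. i \<in> {1..n} \<Longrightarrow> \<epsilon> i \<in> {1, -1 :: real} \<and> img i = \<epsilon> i *\<^sub>R J (unit_vec (\<pi> i))"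
proof -
  obtain \<sigma> where \<sigma>: "\<And>i. i \<in> {1..n} \<Longrightarrow> \<sigma> i \<in> {1..n} \<and> \<bar>coord (img i) (\<sigma> i)\<bar> = 1"
    using ex_unimodular_coord by metis
  have other: "coord (img i) (\<sigma> i') = 0" if "i \<in> {1..n}" "i' \<in> {1..n}" "i \<noteq> i'" for i i'
  proof -
    have "(\<Sum>l\<in>{i, i'}. \<bar>coord (img l) (\<sigma> i')\<bar>) \<le> (\<Sum>l=1..n. \<bar>coord (img l) (\<sigma> i')\<bar>)"
      using that by (intro sum_mono2) auto
    then show ?thesis using row_sum_le[of "\<sigma> i'"] \<sigma>[OF that(2)] that(3) by simp
  qed
  have inj: "inj_on \<sigma> {1..n}"
  proof (rule inj_onI)
    fix i i' assume "i \<in> {1..n}" "i' \<in> {1..n}" "\<sigma> i = \<sigma> i'"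
    then show "i = i'" using other[of i i'] \<sigma>[of i] by (cases "i = i'") auto
  qed
  have surj: "\<sigma> ` {1..n} = {1..n}"
    using \<sigma> inj by (intro endo_inj_surj) auto
  define \<pi> where "\<pi> i = (if i \<in> {1..n} then \<sigma> i else i)" for i
  have "bij_betw \<sigma> {1..n} {1..n}" using inj surj by (simp add: bij_betw_def)
  then have "bij_betw \<pi> {1..n} {1..n}"
    by (rule bij_betw_cong[THEN iffD1, rotated]) (simp add: \<pi>_def)
  then have \<pi>: "\<pi> permutes {1..n}" by (rule bij_imp_permutes) (simp only: \<pi>_def if_False)
  define \<epsilon> where "\<epsilon> i = coord (img i) (\<sigma> i)" for i
  have "\<epsilon> i \<in> {1, -1} \<and> img i = \<epsilon> i *\<^sub>R J (unit_vec (\<pi> i))" if i: "i \<in> {1..n}" for i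
  proof
    show "\<epsilon> i \<in> {1, -1}" using \<sigma>[OF i] by (auto simp: \<epsilon>_def)
    have u: "unit_vec (\<sigma> i) \<in> c00" using \<sigma>[OF i] by (intro unit_vec_in_c00) auto
    have "img i = J (\<lambda>l. \<epsilon> i * unit_vec (\<sigma> i) l)"
    proof (intro eq_J_if_coord_eq scale_in_c00 u)
      fix a
      consider "a = 0" | "a > n" | i' where "i' \<in> {1..n}" "a = \<sigma> i'"
      proof -
        have "a = 0 \<or> a > n \<or> a \<in> \<sigma> ` {1..n}" unfolding surj by auto
        then show thesis using that by blast
      qed
      then show "coord (img i) a = \<epsilon> i * unit_vec (\<sigma> i) a"
      proof cases
        case 1
        then show ?thesis using \<sigma>[OF i] by (auto simp: coord_zero_index unit_vec_def)
      next
        case 2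
        then show ?thesis using coord_img_eq_0[of i a] \<sigma>[OF i] i by (auto simp: unit_vec_def)
      next
        case 3
        show ?thesis
        proof (cases "i = i'")
          case True
          then show ?thesis by (simp add: 3(2) unit_vec_def \<epsilon>_def)
        next
          case False
          then have "\<sigma> i' \<noteq> \<sigma> i" using inj_onD[OF inj _ i 3(1)] by metis
          then show ?thesis using other[OF i 3(1) False] by (simp add: 3(2) unit_vec_def)
        qed
      qed
    qed
    then show "img i = \<epsilon> i *\<^sub>R J (unit_vec (\<pi> i))" using i u by (simp add: J_scale \<pi>_def)
  qed
  then show ?thesis using that[OF \<pi>] by blast
qed

text \<open>
  Writing \<open>U e\<^sub>i = c e\<^sub>i + z\<close>, the norm of \<open>e\<^sub>i + h\<close>, for \<open>h\<close> supported below \<open>i\<close>, turns out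
  to be invariant under translation of \<open>h\<close> by \<open>c z\<close>; as it dominates the coordinates of
  \<open>h\<close>, this forces \<open>z = 0\<close>.
\<close>

lemma img_eq_step:
  assumes i: "n < i" and \<pi>: "\<pi> permutes {1..n}"
    and IH: "\<And>l. 1 \<le> l \<Longrightarrow> l < i \<Longrightarrow> \<epsilon> l \<in> {1, -1 :: real} \<and> img l = \<epsilon> l *\<^sub>R J (unit_vec (\<pi> l))"
  shows "coord (img i) i \<in> {1, -1} \<and> img i = coord (img i) i *\<^sub>R J (unit_vec i)"
proof -
  define c where "c = coord (img i) i"
  define y where "y = trunc i (img i)"
  define z where "z = (\<lambda>l. if l < i then coord (img i) l else 0)"
  have i1: "1 \<le> i" using i by simp
  note ui = unit_vec_in_c00[OF i1]
  have c00: "y \<in> c00" "z \<in> c00"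
    unfolding y_def z_def by (rule trunc_in_c00) (rule in_c00_if_bounded_support[of _ i], auto simp: coord_zero_index)
  have y_eq: "y l = c * unit_vec i l + z l" for l
    by (auto simp: y_def z_def c_def trunc_def coord_proj_def unit_vec_def)
  have img: "img i = J y"
    unfolding y_def using i by (intro eq_J_trunc coord_img_eq_0) auto
  have \<pi>fix: "\<pi> l = l" if "l \<ge> i" for l using permutes_not_in[OF \<pi>] that i by simp
  have \<pi>ne: "\<pi> l = i \<longleftrightarrow> l = i" for l
    using \<pi>fix[of i] permutes_inj[OF \<pi>] by (metis injD order_refl)
  \<comment> \<open>Below \<open>i\<close> the operator is a known signed permutation, so
    \<open>h\<close> is the image of some \<open>g\<close> and \<open>y + h\<close> is the image of
    \<open>unit_vec i + g\<close>. The norm of the latter is unaffected by permuting and changing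
    signs back to \<open>h\<close>.\<close>
  have shift: "N (\<lambda>l. y l + h l) = N (\<lambda>l. unit_vec i l + h l)"
    if h: "h \<in> c00" "\<And>l. l \<ge> i \<Longrightarrow> h l = 0" for h
  proof -
    define g where "g l = (if 1 \<le> l \<and> l < i then \<epsilon> l * h (\<pi> l) else 0)" for l
    have g: "g \<in> c00" by (rule in_c00_if_bounded_support[of _ i]) (auto simp: g_def)
    have "U (J g) = J (\<lambda>l. \<epsilon> (inv \<pi> l) * g (inv \<pi> l))"
      using IH by (intro signed_permutation_image[OF linear_U \<pi> g]) (auto simp: g_def split: if_splits)
    also have "(\<lambda>l. \<epsilon> (inv \<pi> l) * g (inv \<pi> l)) = h"
    proof
      fix l
      show "\<epsilon> (inv \<pi> l) * g (inv \<pi> l) = h l"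
      proof (cases "1 \<le> inv \<pi> l \<and> inv \<pi> l < i")
        case True
        then have "\<epsilon> (inv \<pi> l) * \<epsilon> (inv \<pi> l) = 1" using IH[of "inv \<pi> l"] by auto
        then show ?thesis using True permutes_inverses(1)[OF \<pi>, of l]
          by (simp add: g_def mult.assoc[symmetric])
      next
        case False
        then have "l = 0 \<or> l \<ge> i"
          using permutes_not_in[OF \<pi>, of "inv \<pi> l"] permutes_inverses(1)[OF \<pi>, of l] i by auto
        then have "h l = 0" using h by (auto simp: c00_def)
        then show ?thesis using False by (auto simp: g_def)
      qed
    qed
    finally have Ug: "U (J g) = J h" .
    have "N (\<lambda>l. y l + h l) = norm (J y + J h)"
      using c00 h by (simp add: norm_J add_in_c00 flip: J_add)
    also have "\<dots> = norm (U (J (unit_vec i) + J g))"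
      using img Ug linear_U by (simp add: linear_add)
    also have "\<dots> = N (\<lambda>l. unit_vec i l + g l)"
      using ui g by (simp add: norm_U norm_J add_in_c00 flip: J_add)
    also have "\<dots> = N (\<lambda>l. unit_vec i l + h l)"
    proof (rule norm_permute[symmetric, OF _ _ \<pi>])
      fix l
      have "h (\<pi> l) = 0" if "l = 0 \<or> l \<ge> i"
        using that h \<pi>fix[of l] permutes_not_in[OF \<pi>, of 0] by (auto simp: c00_def)
      then have "\<bar>g l\<bar> = \<bar>h (\<pi> l)\<bar>"
        using IH[of l] by (cases "1 \<le> l \<and> l < i") (auto simp: g_def abs_mult)
      then show "\<bar>unit_vec i (\<pi> l) + h (\<pi> l)\<bar> = \<bar>unit_vec i l + g l\<bar>"
        using \<pi>ne[of l] h(2)[of i] \<pi>fix[of i] by (cases "l = i") (auto simp: unit_vec_def g_def)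
    qed (use ui g h in \<open>auto intro: add_in_c00\<close>)
    finally show ?thesis .
  qed
  have zi: "z l = 0" if "l \<ge> i" for l using that by (simp add: z_def)
  have c1: "\<bar>c\<bar> = 1"
  proof (rule antisym)
    show "\<bar>c\<bar> \<le> 1"
      using coord_le[of "img i" i] i1 by (simp add: c_def norm_U norm_J ui norm_unit_vec)
    \<comment> \<open>Taking \<open>h = - z\<close> in \<open>shift\<close> cancels \<open>z\<close>
      and leaves a multiple of the unit vector, of norm \<open>\<bar>c\<bar>\<close>.\<close>
    have mz: "(\<lambda>l. - z l) \<in> c00" using scale_in_c00[OF c00(2), of "-1"] by simp
    have "1 \<le> N (\<lambda>l. unit_vec i l + - z l)"
      using coord_le_norm[OF add_in_c00[OF ui mz], of i] zi[of i] by (simp add: unit_vec_def)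
    also have "\<dots> = N (\<lambda>l. y l + - z l)" using zi by (intro shift[symmetric] mz) auto
    also have "\<dots> = N (\<lambda>l. c * unit_vec i l)" by (simp add: y_eq)
    also have "\<dots> = \<bar>c\<bar>" using ui i1 by (simp flip: norm_J[OF scale_in_c00] add: J_scale) (simp add: norm_J norm_unit_vec)
    finally show "1 \<le> \<bar>c\<bar>" .
  qed
  then have cc: "c * c = 1" by (metis abs_mult_self_eq mult_1)
  \<comment> \<open>Multiplication by the sign \<open>c\<close> turns the left-hand vector into
    \<open>y + c * h\<close>; \<open>shift\<close> replaces \<open>y\<close> by the unit vector, and
    the sign of \<open>h\<close>, which vanishes at \<open>i\<close>, is then free.\<close>
  have translate: "N (\<lambda>l. unit_vec i l + (c * z l + h l)) = N (\<lambda>l. unit_vec i l + h l)"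
    if h: "h \<in> c00" "\<And>l. l \<ge> i \<Longrightarrow> h l = 0" for h
  proof -
    have "N (\<lambda>l. unit_vec i l + (c * z l + h l)) = N (\<lambda>l. y l + c * h l)"
    proof (rule norm_cong_abs)
      fix l
      have "y l + c * h l = c * unit_vec i l + (c * c) * z l + c * h l" by (simp add: y_eq cc)
      also have "\<dots> = c * (unit_vec i l + (c * z l + h l))" by (simp add: algebra_simps)
      finally show "\<bar>unit_vec i l + (c * z l + h l)\<bar> = \<bar>y l + c * h l\<bar>"
        using c1 by (simp add: abs_mult)
    qed (use c00 ui h in \<open>auto intro!: add_in_c00 scale_in_c00\<close>)
    also have "\<dots> = N (\<lambda>l. unit_vec i l + c * h l)"
      using h by (intro shift scale_in_c00) auto
    also have "\<dots> = N (\<lambda>l. unit_vec i l + h l)"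
    proof (rule norm_cong_abs)
      show "\<bar>unit_vec i l + c * h l\<bar> = \<bar>unit_vec i l + h l\<bar>" for l
        using c1 h(2)[of i] by (cases "l = i") (auto simp: unit_vec_def abs_mult)
    qed (use ui h in \<open>auto intro!: add_in_c00 scale_in_c00\<close>)
    finally show ?thesis .
  qed
  have mult: "N (\<lambda>l. unit_vec i l + real m * c * z l) = 1" for m
  proof (induction m)
    case 0
    then show ?case using norm_unit_vec[OF i1] by simp
  next
    case (Suc m)
    have "N (\<lambda>l. unit_vec i l + (c * z l + real m * c * z l)) = N (\<lambda>l. unit_vec i l + real m * c * z l)"
      using zi by (intro translate scale_in_c00 c00) auto
    then show ?case using Suc by (simp add: algebra_simps)
  qed
  have "z l = 0" for l
  proof (cases "l < i")
    case True
    have "real m * \<bar>z l\<bar> \<le> 1" for m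
    proof -
      have "(\<lambda>l. unit_vec i l + real m * c * z l) \<in> c00"
        by (intro add_in_c00 scale_in_c00 ui c00)
      then show ?thesis
        using coord_le_norm[of _ l] mult[of m] True c1 by (fastforce simp: unit_vec_def abs_mult)
    qed
    then have "\<not> 0 < \<bar>z l\<bar>" using reals_Archimedean3[of "\<bar>z l\<bar>"] by (metis not_less)
    then show ?thesis by simp
  qed (simp add: zi)
  then have "y = (\<lambda>l. c * unit_vec i l)" using y_eq by auto
  then have "img i = c *\<^sub>R J (unit_vec i)" using img J_scale[OF ui] by simp
  then show ?thesis using c1 unfolding c_def by auto
qed

text \<open>Strong induction: up to \<open>n\<close> the initial block supplies the signs, and
  beyond \<open>n\<close>, where \<open>\<pi>\<close> is the identity, \<open>img_eq_step\<close>
  supplies the diagonal coordinate as the sign.\<close>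

lemma signed_permutation:
  obtains \<pi> \<epsilon> where "\<pi> permutes {1..n}"
    "\<And>i. 1 \<le> i \<Longrightarrow> \<epsilon> i \<in> {1, -1 :: real} \<and> img i = \<epsilon> i *\<^sub>R J (unit_vec (\<pi> i))"
proof -
  obtain \<pi> \<epsilon>0 where \<pi>: "\<pi> permutes {1..n}" and
    \<epsilon>0: "\<And>i. i \<in> {1..n} \<Longrightarrow> \<epsilon>0 i \<in> {1, -1 :: real} \<and> img i = \<epsilon>0 i *\<^sub>R J (unit_vec (\<pi> i))"
    using signed_permutation_initial by blast
  define \<epsilon> where "\<epsilon> i = (if i \<le> n then \<epsilon>0 i else coord (img i) i)" for i
  have "\<epsilon> i \<in> {1, -1} \<and> img i = \<epsilon> i *\<^sub>R J (unit_vec (\<pi> i))" if "1 \<le> i" for i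
    using that
  proof (induction i rule: less_induct)
    case (less i)
    show ?case
    proof (cases "i \<le> n")
      case True
      then show ?thesis using \<epsilon>0[of i] less.prems by (simp add: \<epsilon>_def)
    next
      case False
      then have "\<pi> i = i" using permutes_not_in[OF \<pi>] by simp
      then show ?thesis using False img_eq_step[OF _ \<pi>, of i \<epsilon>] less.IH by (simp add: \<epsilon>_def)
    qed
  qed
  then show ?thesis using that[OF \<pi>] by blast
qed

end

section \<open>The converse direction and the characterisation\<close>

text \<open>By \<open>norm_permute\<close> the operator preserves norms on the dense image of
  \<open>c00\<close>, hence everywhere. Its range contains this image and is closed, being an
  isometric copy of a complete space.\<close>

lemma (in tsirelson_space) signed_permutation_in_Isom:
  assumes U: "bounded_linear U" and \<pi>: "\<pi> permutes {1..n}"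
    and \<epsilon>: "\<And>i. 1 \<le> i \<Longrightarrow> \<epsilon> i \<in> {1, -1 :: real} \<and> U (J (unit_vec i)) = \<epsilon> i *\<^sub>R J (unit_vec (\<pi> i))"
  shows "U \<in> Isom"
proof -
  have lin: "linear U" using U by (rule bounded_linear.linear)
  have \<pi>0: "\<pi> 0 = 0" using permutes_not_in[OF \<pi>] by simp
  have U_J: "(\<lambda>l. \<epsilon> (inv \<pi> l) * z (inv \<pi> l)) \<in> c00" "U (J z) = J (\<lambda>l. \<epsilon> (inv \<pi> l) * z (inv \<pi> l))"
    if "z \<in> c00" for z
  proof -
    have "1 \<le> j" if "z j \<noteq> 0" for j using that \<open>z \<in> c00\<close> by (cases j) (auto simp: c00_def)
    then show "(\<lambda>l. \<epsilon> (inv \<pi> l) * z (inv \<pi> l)) \<in> c00" "U (J z) = J (\<lambda>l. \<epsilon> (inv \<pi> l) * z (inv \<pi> l))"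
      using \<epsilon> signed_permutation_image[OF lin \<pi> that] by blast+
  qed
  have norm_U_J: "norm (U (J z)) = norm (J z)" if z: "z \<in> c00" for z
  proof -
    have "N (\<lambda>l. \<epsilon> (inv \<pi> l) * z (inv \<pi> l)) = N z"
    proof (rule norm_permute[OF z U_J(1)[OF z] \<pi>])
      fix l
      show "\<bar>\<epsilon> (inv \<pi> (\<pi> l)) * z (inv \<pi> (\<pi> l))\<bar> = \<bar>z l\<bar>"
        using \<epsilon>[of l] z permutes_inverses(2)[OF \<pi>, of l] by (cases "l = 0") (auto simp: abs_mult c00_def)
    qed
    then show ?thesis using U_J[OF z] z by (simp add: norm_J)
  qed
  have norm_U: "norm (U v) = norm v" for v
  proof (rule LIMSEQ_unique)
    show "(\<lambda>k. norm (U (J (approx v k)))) \<longlonglongrightarrow> norm (U v)"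
      by (intro tendsto_norm bounded_linear.tendsto[OF U] approx)
    show "(\<lambda>k. norm (U (J (approx v k)))) \<longlonglongrightarrow> norm v"
      using tendsto_norm[OF approx(2)] by (simp add: norm_U_J approx)
  qed
  have "J z \<in> range U" if z: "z \<in> c00" for z
  proof -
    \<comment> \<open>A preimage of \<open>z\<close>: pull back along \<open>\<pi>\<close> and apply
      the signs, which are their own inverses.\<close>
    define g where "g l = (if l = 0 then 0 else \<epsilon> l * z (\<pi> l))" for l
    have "{l. g l \<noteq> 0} \<subseteq> inv \<pi> ` {l. z l \<noteq> 0}"
    proof
      fix l assume "l \<in> {l. g l \<noteq> 0}"
      then have "z (\<pi> l) \<noteq> 0" by (auto simp: g_def split: if_splits)
      then show "l \<in> inv \<pi> ` {l. z l \<noteq> 0}"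
        using permutes_inverses(2)[OF \<pi>, of l] by (metis (mono_tags, lifting) imageI mem_Collect_eq)
    qed
    then have "finite {l. g l \<noteq> 0}" using z by (auto simp: c00_def intro: finite_subset)
    then have g: "g \<in> c00" by (simp add: c00_def g_def)
    have "(\<lambda>l. \<epsilon> (inv \<pi> l) * g (inv \<pi> l)) = z"
    proof
      fix l
      show "\<epsilon> (inv \<pi> l) * g (inv \<pi> l) = z l"
      proof (cases "inv \<pi> l = 0")
        case True
        then have "l = 0" using permutes_inverses(1)[OF \<pi>, of l] \<pi>0 by simp
        then show ?thesis using z True by (simp add: g_def c00_def)
      next
        case False
        then have "\<epsilon> (inv \<pi> l) * \<epsilon> (inv \<pi> l) = 1" using \<epsilon>[of "inv \<pi> l"] by auto
        then show ?thesis using False permutes_inverses(1)[OF \<pi>, of l]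
          by (simp add: g_def mult.assoc[symmetric])
      qed
    qed
    then have "U (J g) = J z" using U_J(2)[OF g] by simp
    then show ?thesis by (metis rangeI)
  qed
  moreover have "closed (range U)"
    using complete_isometric_image[of 1 UNIV U] U norm_U
    by (simp add: complete_UNIV complete_eq_closed)
  ultimately have "closure (J ` c00) \<subseteq> range U" by (intro closure_minimal) auto
  then show ?thesis using closure_J lin norm_U by (auto simp: Isom_def)
qed

theorem theorem4p1:
  fixes n :: nat
    and J :: "(nat \<Rightarrow> real) \<Rightarrow> 'a::banach"
    and U :: "'a \<Rightarrow> 'a"
  assumes "n \<ge> 2"
    and "is_tsirelson_space (1 / real n) J"
    and "bounded_linear U"
  shows "U \<in> Isom \<longleftrightarrow>
    (\<exists>(\<pi> :: nat \<Rightarrow> nat) (\<epsilon> :: nat \<Rightarrow> real).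
       \<pi> permutes {1..n} \<and>
       (\<forall>i\<ge>1. \<epsilon> i \<in> {1, -1}) \<and>
       (\<forall>i\<in>{1..n}. U (J (unit_vec i)) = \<epsilon> i *\<^sub>R J (unit_vec (\<pi> i))) \<and>
       (\<forall>i\<ge>n + 1. U (J (unit_vec i)) = \<epsilon> i *\<^sub>R J (unit_vec i)))"
    (is "_ \<longleftrightarrow> ?R")
proof -
  interpret tsirelson_space n J
    using assms by unfold_locales
  show ?thesis
  proof
    assume "U \<in> Isom"
    then interpret tsirelson_isometry n J U
      using assms(3) by (intro tsirelson_isometry.intro tsirelson_isometry_axioms.intro tsirelson_space_axioms)
        (auto simp: Isom_def)
    obtain \<pi> \<epsilon> where \<pi>: "\<pi> permutes {1..n}" and
      \<epsilon>: "\<And>i. 1 \<le> i \<Longrightarrow> \<epsilon> i \<in> {1, -1 :: real} \<and> img i = \<epsilon> i *\<^sub>R J (unit_vec (\<pi> i))"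
      using signed_permutation by blast
    have "img i = \<epsilon> i *\<^sub>R J (unit_vec i)" if "i \<ge> n + 1" for i
      using \<epsilon>[of i] permutes_not_in[OF \<pi>, of i] that by simp
    then show ?R using \<pi> \<epsilon> by (intro exI[of _ \<pi>] exI[of _ \<epsilon>]) simp
  next
    assume ?R
    then obtain \<pi> \<epsilon> where \<pi>: "\<pi> permutes {1..n}" and \<epsilon>: "\<forall>i\<ge>1. \<epsilon> i \<in> {1, -1 :: real}"
      "\<forall>i\<in>{1..n}. U (J (unit_vec i)) = \<epsilon> i *\<^sub>R J (unit_vec (\<pi> i))"
      "\<forall>i\<ge>n + 1. U (J (unit_vec i)) = \<epsilon> i *\<^sub>R J (unit_vec i)" by blast
    have "U (J (unit_vec i)) = \<epsilon> i *\<^sub>R J (unit_vec (\<pi> i))" if "1 \<le> i" for i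
      using \<epsilon> that permutes_not_in[OF \<pi>, of i] by (cases "i \<le> n") auto
    then show "U \<in> Isom"
      using \<epsilon>(1) by (intro signed_permutation_in_Isom[OF assms(3) \<pi>]) blast
  qed
qed

end
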